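(* Let $H$ be a complex Hilbert space and let $A,B\in B(H)$ be such that $AB=BA$. If $A$ is normal and $B$ is hyponormal, then both inequalities $\big\||A|-|B|\big\|\leq \|A+B\|$ and $\big\||A|-|B|\big\|\leq \|A-B\|$ hold.
   Context: $B(H)$ denotes the algebra of bounded linear operators on $H$, with operator norm $\|\cdot\|$. For $T\in B(H)$, $|T|=\sqrt{T^*T}$ denotes the absolute value (modulus) of $T$, i.e. the unique positive square root of $T^*T$. An operator $T$ is normal if $TT^*=T^*T$, and hyponormal if $TT^*\leq T^*T$ (meaning $T^*T-TT^*$ is positive), equivalently $\|T^*x\|\leq\|Tx\|$ for all $x\in H$. *)

theory Defs
  imports "HOL-Analysis.Analysis"
begin

class complex_vector = real_vector +
  fixes scaleC :: "complex \<Rightarrow> 'a \<Rightarrow> 'a"  (infixr "*\<^sub>C" 75)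
  assumes scaleC_add_right: "c *\<^sub>C (x + y) = c *\<^sub>C x + c *\<^sub>C y"
    and scaleC_add_left: "(c + d) *\<^sub>C x = c *\<^sub>C x + d *\<^sub>C x"
    and scaleC_scaleC: "c *\<^sub>C (d *\<^sub>C x) = (c * d) *\<^sub>C x"
    and scaleC_one: "1 *\<^sub>C x = x"
    and scaleR_scaleC: "r *\<^sub>R x = complex_of_real r *\<^sub>C x"

(* A complex inner product, linear in the first argument. The underlying real
   inner product is its real part, so that real_inner supplies positive
   definiteness and the norm, metric and topology are those induced by cinner. *)
class complex_inner = complex_vector + real_inner +
  fixes cinner :: "'a \<Rightarrow> 'a \<Rightarrow> complex"
  assumes cinner_commute: "cinner x y = cnj (cinner y x)"
    and cinner_add_left: "cinner (x + y) z = cinner x z + cinner y z"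
    and cinner_scaleC_left: "cinner (c *\<^sub>C x) y = c * cinner x y"
    and inner_eq_Re_cinner: "x \<bullet> y = Re (cinner x y)"

class chilbert_space = complex_inner + complete_space

lemma cinner_self: "cinner x x = complex_of_real ((norm x)\<^sup>2)"
proof -
  have "Im (cinner x x) = 0"
    using arg_cong[OF cinner_commute[of x x], of Im] by simp
  then show ?thesis
    by (simp add: complex_eq_iff power2_norm_eq_inner inner_eq_Re_cinner)
qed

instantiation complex :: chilbert_space
begin
definition scaleC_complex_def: "c *\<^sub>C (x::complex) = c * x"
definition cinner_complex_def: "cinner (x::complex) y = x * cnj y"
instance
  by standard
    (auto simp: scaleC_complex_def cinner_complex_def inner_complex_def
        algebra_simps scaleR_conv_of_real)
end

(* Membership in B(H). The operator norm is the library's onorm. *)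
definition bounded_clinear :: "('a::complex_inner \<Rightarrow> 'a) \<Rightarrow> bool" where
  "bounded_clinear T \<longleftrightarrow> bounded_linear T \<and> (\<forall>c x. T (c *\<^sub>C x) = c *\<^sub>C T x)"

(* For T in B(H) there is exactly one such S (Riesz representation). *)
definition adjoint_op :: "('a::chilbert_space \<Rightarrow> 'a) \<Rightarrow> ('a \<Rightarrow> 'a)" where
  "adjoint_op T = (THE S. \<forall>x y. cinner (T x) y = cinner x (S y))"

definition positive_op :: "('a::chilbert_space \<Rightarrow> 'a) \<Rightarrow> bool" where
  "positive_op T \<longleftrightarrow> bounded_clinear T \<and> (\<forall>x. cinner (T x) x \<in> \<real>\<^sub>\<ge>\<^sub>0)"

definition normal_op :: "('a::chilbert_space \<Rightarrow> 'a) \<Rightarrow> bool" where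
  "normal_op T \<longleftrightarrow> T \<circ> adjoint_op T = adjoint_op T \<circ> T"

definition hyponormal_op :: "('a::chilbert_space \<Rightarrow> 'a) \<Rightarrow> bool" where
  "hyponormal_op T \<longleftrightarrow> positive_op (\<lambda>x. adjoint_op T (T x) - T (adjoint_op T x))"

(* For T in B(H) there is exactly one such S, the positive square root. *)
definition modulus_op :: "('a::chilbert_space \<Rightarrow> 'a) \<Rightarrow> ('a \<Rightarrow> 'a)" where
  "modulus_op T = (THE S. positive_op S \<and> S \<circ> S = adjoint_op T \<circ> T)"

end

theory Submission imports Defs begin

text \<open>
  Write \<open>P = |A|\<close> and \<open>Q = |B|\<close>. The bound holds even pointwise,
  \<open>norm ((P - Q) x) \<le> norm ((A \<plusminus> B) x)\<close> (\<open>norm_root_diff_le\<close>). Since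
  \<open>norm (A x) = norm (P x)\<close> and \<open>norm (B x) = norm (Q x)\<close>, expanding the squares
  reduces it to \<open>\<bar>A x \<bullet> B x\<bar> \<le> P x \<bullet> Q x\<close>, where \<open>\<bullet>\<close> is the real part of the complex
  inner product. The left side is the quadratic form of \<open>M = (B\<^sup>* A + A\<^sup>* B) / 2\<close>. If \<open>P\<close> commutes
  with \<open>B\<close>, it commutes with \<open>Q\<close>, so \<open>R = P Q\<close> is positive, and its form is the right side.
  Hyponormality of \<open>B\<close> and normality of \<open>A\<close> bound both \<open>norm (B\<^sup>* A x)\<close> and
  \<open>norm (A\<^sup>* B x)\<close> by \<open>norm (A B x) = norm (P Q x)\<close>, hence
  \<open>norm (M x) \<le> norm (R x)\<close> for all \<open>x\<close>. A symmetric operator that is dominated in this sense by a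
  positive one is dominated by it as a quadratic form (\<open>form_le_of_norm_le\<close>, the operator
  monotonicity of the square root), and applying this to \<open>M\<close> and \<open>- M\<close> finishes the argument.

  What remains is that \<open>P\<close> commutes with \<open>B\<close>, equivalently that \<open>D = A\<^sup>* A\<close> does; this is the part
  of Fuglede's theorem that the argument needs (\<open>normal_square_commutes\<close>). Normality gives
  \<open>norm (D\<^sup>n x) = norm (A\<^bsup>2n\<^esup> x)\<close>, so \<open>A B = B A\<close> yields
  \<open>norm (D\<^sup>n (B x)) \<le> norm B * norm (D\<^sup>n x)\<close> for every \<open>n\<close>, and the same for \<open>B\<^sup>*\<close> because \<open>B\<^sup>*\<close>
  commutes with \<open>A\<^sup>*\<close>. The spectral subspace of \<open>D\<close> for \<open>[0, r]\<close> consists of the \<open>x\<close> for which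
  \<open>norm (D\<^sup>n x)\<close> is \<open>O(r\<^sup>n)\<close>; hence \<open>B\<close> and \<open>B\<^sup>*\<close> both preserve it. Cutting the spectrum
  of \<open>D\<close> into intervals of length \<open>d\<close> makes \<open>B\<close> block diagonal, and on each block \<open>D\<close> is
  within \<open>d\<close> of a scalar, so the commutator of \<open>D\<close> and \<open>B\<close> has norm at most
  \<open>2 * norm B * d\<close>; let \<open>d\<close> tend to \<open>0\<close> (\<open>commute_if_growth_bounds\<close>).

  Everything except the final translation takes place in a real Hilbert space. Complex linearity
  amounts to commuting with multiplication by \<open>\<i>\<close>, and the square root commutes with every
  operator that commutes with its square. The spectral subspaces are built without a spectral
  measure, as kernels of positive parts \<open>(D - r)\<^sup>+ = (|D - r| + (D - r)) / 2\<close>.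
\<close>

section \<open>Positive semidefinite operators\<close>

definition symmetric :: "('a::real_inner \<Rightarrow>\<^sub>L 'a) \<Rightarrow> bool" where
  "symmetric T \<longleftrightarrow> (\<forall>x y. T x \<bullet> y = x \<bullet> T y)"

text \<open>
  Over the reals a nonnegative quadratic form does not force symmetry, so symmetry is part of the
  notion.
\<close>

definition pos_semidef :: "('a::real_inner \<Rightarrow>\<^sub>L 'a) \<Rightarrow> bool" where
  "pos_semidef T \<longleftrightarrow> symmetric T \<and> (\<forall>x. 0 \<le> T x \<bullet> x)"

definition commute :: "('a::real_normed_vector \<Rightarrow>\<^sub>L 'a) \<Rightarrow> ('a \<Rightarrow>\<^sub>L 'a) \<Rightarrow> bool" where
  "commute S T \<longleftrightarrow> (\<forall>x. S (T x) = T (S x))"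

lemma symmetricD: "symmetric T \<Longrightarrow> T x \<bullet> y = x \<bullet> T y"
  by (simp add: symmetric_def)

lemma pos_semidefD: "pos_semidef T \<Longrightarrow> symmetric T" "pos_semidef T \<Longrightarrow> 0 \<le> T x \<bullet> x"
  by (simp_all add: pos_semidef_def)

lemma commuteD: "commute S T \<Longrightarrow> S (T x) = T (S x)"
  by (simp add: commute_def)

lemma commute_sym: "commute S T \<Longrightarrow> commute T S"
  by (simp add: commute_def)

lemma symmetric_intros:
  "symmetric id_blinfun"
  "symmetric S \<Longrightarrow> symmetric T \<Longrightarrow> symmetric (S + T)"
  "symmetric S \<Longrightarrow> symmetric T \<Longrightarrow> symmetric (S - T)"
  "symmetric S \<Longrightarrow> symmetric (- S)"
  "symmetric S \<Longrightarrow> symmetric (c *\<^sub>R S)"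
  "symmetric S \<Longrightarrow> symmetric T \<Longrightarrow> commute S T \<Longrightarrow> symmetric (S o\<^sub>L T)"
  by (simp_all add: symmetric_def commute_def blinfun.bilinear_simps inner_simps)

lemma commute_intros:
  "commute T id_blinfun"
  "commute T R \<Longrightarrow> commute T S \<Longrightarrow> commute T (R + S)"
  "commute T R \<Longrightarrow> commute T S \<Longrightarrow> commute T (R - S)"
  "commute T S \<Longrightarrow> commute T (c *\<^sub>R S)"
  "commute T R \<Longrightarrow> commute T S \<Longrightarrow> commute T (R o\<^sub>L S)"
  by (simp_all add: commute_def blinfun.bilinear_simps)

lemma inner_blinfun_le:
  fixes T :: "'a::real_inner \<Rightarrow>\<^sub>L 'a"
  shows "T x \<bullet> x \<le> norm T * (norm x)\<^sup>2"
proof -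
  have "T x \<bullet> x \<le> norm (T x) * norm x" by (rule norm_cauchy_schwarz)
  also have "\<dots> \<le> (norm T * norm x) * norm x"
    by (intro mult_right_mono norm_blinfun) simp
  finally show ?thesis by (simp add: power2_eq_square mult.assoc)
qed

lemma nonneg_quadratic_discriminant:
  fixes a b c :: real
  assumes "0 \<le> c" and q: "\<And>t. 0 \<le> a + 2 * t * b + t\<^sup>2 * c"
  shows "b\<^sup>2 \<le> a * c"
proof (cases "c = 0")
  case True
  have "b = 0"
  proof (rule ccontr)
    assume "b \<noteq> 0"
    define s where "s = (a + 1) / (2 * b)"
    have "s * (2 * b) = a + 1" using \<open>b \<noteq> 0\<close> by (simp add: s_def)
    then have "2 * (- s) * b = - (a + 1)" by simp
    then show False using q[of "- s"] True by simp
  qed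
  with True show ?thesis by simp
next
  case False
  then have "c > 0" using \<open>0 \<le> c\<close> by simp
  have "a + 2 * (- b / c) * b + (- b / c)\<^sup>2 * c = a - b\<^sup>2 / c"
    using False by (simp add: power2_eq_square)
  then have "0 \<le> a - b\<^sup>2 / c" using q[of "- b / c"] by simp
  with \<open>c > 0\<close> show ?thesis by (simp add: pos_divide_le_eq)
qed

lemma positive_Cauchy_Schwarz:
  assumes "pos_semidef T"
  shows "(T x \<bullet> y)\<^sup>2 \<le> (T x \<bullet> x) * (T y \<bullet> y)"
proof (rule nonneg_quadratic_discriminant)
  show "0 \<le> T y \<bullet> y" by (rule pos_semidefD[OF assms])
  have sym: "T y \<bullet> x = T x \<bullet> y"
    using symmetricD[OF pos_semidefD(1)[OF assms], of y x] by (simp add: inner_commute)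
  fix t
  have "0 \<le> T (x + t *\<^sub>R y) \<bullet> (x + t *\<^sub>R y)" by (rule pos_semidefD[OF assms])
  also have "\<dots> = T x \<bullet> x + 2 * t * (T x \<bullet> y) + t\<^sup>2 * (T y \<bullet> y)"
    by (simp add: blinfun.bilinear_simps inner_simps sym power2_eq_square algebra_simps)
  finally show "0 \<le> T x \<bullet> x + 2 * t * (T x \<bullet> y) + t\<^sup>2 * (T y \<bullet> y)" .
qed

text \<open>
  If the form of \<open>T\<close> is at most \<open>d\<close> on a subspace invariant under \<open>T\<close>, then the norm of \<open>T\<close> is at
  most \<open>d\<close> there; for one vector \<open>x\<close> it suffices to know the bound at \<open>x\<close> and at \<open>T x\<close>, by
  Cauchy--Schwarz for the form of \<open>T\<close> applied to \<open>x\<close> and \<open>T x\<close>.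
\<close>

lemma positive_norm_le_local:
  assumes T: "pos_semidef T" and "0 \<le> d"
    and x: "T x \<bullet> x \<le> d * (norm x)\<^sup>2" and Tx: "T (T x) \<bullet> T x \<le> d * (norm (T x))\<^sup>2"
  shows "norm (T x) \<le> d * norm x"
proof (cases "T x = 0")
  case False
  have "((norm (T x))\<^sup>2)\<^sup>2 = (T x \<bullet> T x)\<^sup>2" by (simp add: power2_norm_eq_inner)
  also have "\<dots> \<le> (T x \<bullet> x) * (T (T x) \<bullet> T x)" by (rule positive_Cauchy_Schwarz[OF T])
  also have "\<dots> \<le> (d * (norm x)\<^sup>2) * (d * (norm (T x))\<^sup>2)"
    using x Tx pos_semidefD(2)[OF T] \<open>0 \<le> d\<close> by (intro mult_mono) auto
  finally have "(norm (T x))\<^sup>2 * (norm (T x))\<^sup>2 \<le> (d * norm x)\<^sup>2 * (norm (T x))\<^sup>2"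
    by (simp add: power2_eq_square algebra_simps)
  then have "(norm (T x))\<^sup>2 \<le> (d * norm x)\<^sup>2"
    by (rule mult_right_le_imp_le) (use False in simp)
  then show ?thesis by (rule power2_le_imp_le) (use \<open>0 \<le> d\<close> in simp)
qed (use \<open>0 \<le> d\<close> in simp)

lemma positive_norm_le:
  assumes "pos_semidef T" "0 \<le> d" "\<And>x. T x \<bullet> x \<le> d * (norm x)\<^sup>2"
  shows "norm T \<le> d"
  by (intro norm_blinfun_bound positive_norm_le_local assms)

text \<open>
  A vector on which the form of a positive operator is almost zero is an approximate null vector.
  Applied to \<open>S - l\<close> with \<open>l\<close> the infimum of the form of \<open>S\<close> on the unit sphere, this produces
  approximate eigenvectors of \<open>S\<close>.
\<close>

lemma positive_image_small:
  assumes T: "pos_semidef T"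
  shows "(norm (T x))\<^sup>2 \<le> norm T * (T x \<bullet> x)"
proof (cases "T x = 0")
  case False
  have "((norm (T x))\<^sup>2)\<^sup>2 = (T x \<bullet> T x)\<^sup>2" by (simp add: power2_norm_eq_inner)
  also have "\<dots> \<le> (T x \<bullet> x) * (T (T x) \<bullet> T x)" by (rule positive_Cauchy_Schwarz[OF T])
  also have "\<dots> \<le> (T x \<bullet> x) * (norm T * (norm (T x))\<^sup>2)"
    using pos_semidefD(2)[OF T] by (intro mult_left_mono inner_blinfun_le)
  finally have "(norm (T x))\<^sup>2 * (norm (T x))\<^sup>2 \<le> (norm T * (T x \<bullet> x)) * (norm (T x))\<^sup>2"
    by (simp add: power2_eq_square algebra_simps)
  then show ?thesis by (rule mult_right_le_imp_le) (use False in simp)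
qed (simp add: pos_semidefD[OF T])

lemma form_lower_bound_unit:
  fixes T :: "'a::real_inner \<Rightarrow>\<^sub>L 'a"
  assumes "\<And>u. norm u = 1 \<Longrightarrow> l \<le> T u \<bullet> u"
  shows "l * (norm x)\<^sup>2 \<le> T x \<bullet> x"
proof (cases "x = 0")
  case False
  have "l \<le> T (sgn x) \<bullet> sgn x" using False by (intro assms) (simp add: norm_sgn)
  also have "\<dots> = (T x \<bullet> x) / (norm x)\<^sup>2"
    by (simp add: sgn_div_norm blinfun.bilinear_simps power2_eq_square divide_inverse)
  finally show ?thesis using False by (simp add: field_simps)
qed (simp add: blinfun.bilinear_simps)

text \<open>
  Operator monotonicity of the square root: the hypothesis says \<open>M\<^sup>2 \<le> R\<^sup>2\<close>. Let \<open>S = R - M\<close> and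
  \<open>W = R + M\<close>; then \<open>S x \<bullet> W x = (norm (R x))\<^sup>2 - (norm (M x))\<^sup>2 \<ge> 0\<close>. If the infimum \<open>l\<close> of the
  form of \<open>S\<close> were negative, take a unit vector \<open>u\<close> with \<open>S u\<close> close to \<open>l u\<close>. Then
  \<open>l * (u \<bullet> W u)\<close> is almost nonnegative, while \<open>u \<bullet> W u = 2 * (R u \<bullet> u) - S u \<bullet> u\<close> is at least
  about \<open>- l > 0\<close>, a contradiction.
\<close>

lemma form_le_of_norm_le:
  assumes M: "symmetric M" and R: "pos_semidef R" and le: "\<And>x. norm (M x) \<le> norm (R x)"
  shows "M x \<bullet> x \<le> R x \<bullet> x"
proof (rule ccontr)
  assume "\<not> M x \<bullet> x \<le> R x \<bullet> x"
  define S where "S = R - M"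
  have S: "symmetric S" unfolding S_def by (intro symmetric_intros M pos_semidefD(1)[OF R])
  have neg: "S x \<bullet> x < 0"
    using \<open>\<not> _\<close> by (simp add: S_def blinfun.bilinear_simps inner_simps)
  define V where "V = {S u \<bullet> u | u. norm u = 1}"
  define l where "l = Inf V"
  have x0: "x \<noteq> 0" using neg by auto
  have bdd: "bdd_below V"
  proof (rule bdd_belowI)
    fix v assume "v \<in> V"
    then obtain u where u: "norm u = 1" "v = S u \<bullet> u" by (auto simp: V_def)
    have "(- S) u \<bullet> u \<le> norm (- S) * (norm u)\<^sup>2" by (rule inner_blinfun_le)
    then show "- norm S \<le> v" using u by (simp add: blinfun.bilinear_simps)
  qed
  have sgnV: "S (sgn x) \<bullet> sgn x \<in> V"
    using x0 by (auto simp: V_def norm_sgn intro!: exI[of _ "sgn x"])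
  have l_le: "l \<le> S u \<bullet> u" if "norm u = 1" for u
    unfolding l_def using that by (intro cInf_lower[OF _ bdd]) (auto simp: V_def)
  have lx: "l * (norm x)\<^sup>2 \<le> S x \<bullet> x" by (rule form_lower_bound_unit[OF l_le])
  have l0: "l < 0" using lx neg x0
    by (smt (verit) mult_nonneg_nonneg zero_le_power2)
  define N where "N = S - l *\<^sub>R id_blinfun"
  have N: "pos_semidef N"
    unfolding pos_semidef_def
  proof (intro conjI allI)
    show "symmetric N" unfolding N_def using S by (intro symmetric_intros)
    show "0 \<le> N y \<bullet> y" for y
      using form_lower_bound_unit[OF l_le, of y]
      by (simp add: N_def blinfun.bilinear_simps inner_simps power2_norm_eq_inner)
  qed
  define W where "W = R + M"
  have key: "l\<^sup>2 \<le> - l * e + sqrt (norm N * e) * norm W" if e: "0 < e" for e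
  proof -
    obtain v where "v \<in> V" "v < l + e"
      using cInf_lessD[of V "l + e"] sgnV e unfolding l_def by auto
    then obtain u where u: "norm u = 1" and Su: "S u \<bullet> u < l + e" by (auto simp: V_def)
    have uu: "u \<bullet> u = 1" using u by (simp add: norm_eq_1)
    have Nu: "N u \<bullet> u < e"
      using Su uu by (simp add: N_def blinfun.bilinear_simps inner_simps)
    have "(norm (N u))\<^sup>2 \<le> norm N * e"
      using positive_image_small[OF N, of u] Nu
      by (smt (verit) mult_left_mono norm_ge_zero)
    then have nN: "norm (N u) \<le> sqrt (norm N * e)" by (rule real_le_rsqrt)
    have Seq: "S u = l *\<^sub>R u + N u" by (simp add: N_def blinfun.bilinear_simps)
    have "S u \<bullet> W u = (norm (R u))\<^sup>2 - (norm (M u))\<^sup>2"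
      by (simp add: S_def W_def blinfun.bilinear_simps inner_simps power2_norm_eq_inner
          inner_commute)
    also have "\<dots> \<ge> 0" using le[of u] by (simp add: power_mono)
    finally have "0 \<le> l * (u \<bullet> W u) + N u \<bullet> W u" by (simp add: Seq inner_simps)
    moreover have "N u \<bullet> W u \<le> sqrt (norm N * e) * norm W"
    proof -
      have "N u \<bullet> W u \<le> norm (N u) * norm (W u)" by (rule norm_cauchy_schwarz)
      also have "\<dots> \<le> sqrt (norm N * e) * norm W"
        using nN norm_blinfun[of W u] u e by (intro mult_mono) auto
      finally show ?thesis .
    qed
    moreover have "u \<bullet> W u \<ge> - (l + e)"
    proof -
      have "u \<bullet> W u = 2 * (R u \<bullet> u) - S u \<bullet> u"
        by (simp add: S_def W_def blinfun.bilinear_simps inner_simps inner_commute)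
      then show ?thesis using Su pos_semidefD(2)[OF R, of u] by simp
    qed
    then have "l * (u \<bullet> W u) \<le> l * (- (l + e))"
      using l0 by (intro mult_left_mono_neg) auto
    ultimately show ?thesis by (simp add: power2_eq_square algebra_simps)
  qed
  have "((\<lambda>e. - l * e + sqrt (norm N * e) * norm W) \<longlongrightarrow> - l * 0 + sqrt (norm N * 0) * norm W) (at_right 0)"
    by (intro tendsto_intros)
  then have "l\<^sup>2 \<le> - l * 0 + sqrt (norm N * 0) * norm W"
    by (rule tendsto_lowerbound) (use key in \<open>auto intro!: eventually_at_rightI[of 0 1]\<close>)
  then show False using l0 by simp
qed

lemma symmetric_form_zero:
  assumes S: "symmetric S" and z: "\<And>x. S x \<bullet> x = 0"
  shows "S x = 0"
proof -
  have "pos_semidef S" using assms by (simp add: pos_semidef_def)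
  from positive_image_small[OF this, of x] show ?thesis using z by simp
qed

section \<open>Square roots\<close>

lemma positive_root_unique:
  assumes S: "pos_semidef S" and T: "pos_semidef T" and eq: "\<And>x. S (S x) = T (T x)"
  shows "S = T"
proof -
  have nrm: "norm (S x) = norm (T x)" for x
  proof -
    have "S x \<bullet> S x = T x \<bullet> T x"
      using arg_cong[OF eq[of x], of "\<lambda>v. x \<bullet> v"]
      by (simp only: symmetricD[OF pos_semidefD(1)[OF S]] symmetricD[OF pos_semidefD(1)[OF T]])
    then show ?thesis by (simp add: norm_eq)
  qed
  have "(S - T) x = 0" for x
  proof (rule symmetric_form_zero)
    show "symmetric (S - T)" by (intro symmetric_intros pos_semidefD(1) S T)
    show "(S - T) x \<bullet> x = 0" for x
      using form_le_of_norm_le[OF pos_semidefD(1)[OF S] T, of x] form_le_of_norm_le[OF pos_semidefD(1)[OF T] S, of x] nrm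
      by (simp add: blinfun.bilinear_simps inner_simps)
  qed
  then have "S x = T x" for x by (simp add: blinfun.diff_left)
  then show ?thesis by (rule blinfun_eqI)
qed

text \<open>
  With \<open>Y = 1 - S\<close>, the equation \<open>S\<^sup>2 = 1 - X\<close> becomes the fixed point equation
  \<open>Y = (X + Y\<^sup>2) / 2\<close>. On the ball of radius \<open>q < 1\<close> the right side is a contraction, and it preserves
  the closed set of symmetric operators that commute with everything commuting with \<open>X\<close>.
\<close>

lemma contraction_root:
  fixes X :: "'a::{real_inner,banach} \<Rightarrow>\<^sub>L 'a"
  assumes X: "symmetric X" and nX: "norm X \<le> q" and q: "q < 1"
  shows "\<exists>Y. symmetric Y \<and> norm Y \<le> q \<and> (\<forall>T. commute T X \<longrightarrow> commute T Y) \<and>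
    (\<forall>x. 2 *\<^sub>R Y x = X x + Y (Y x))"
proof -
  define K where "K = {Y :: 'a \<Rightarrow>\<^sub>L 'a. norm Y \<le> q \<and> symmetric Y \<and> (\<forall>T. commute T X \<longrightarrow> commute T Y)}"
  define f where "f Y = (1/2) *\<^sub>R (X + (Y o\<^sub>L Y))" for Y :: "'a \<Rightarrow>\<^sub>L 'a"
  have q0: "0 \<le> q" using nX norm_ge_zero[of X] by linarith
  have Kcl: "closed K"
  proof -
    have "K = {Y. norm Y \<le> q} \<inter> (\<Inter>x. \<Inter>y. {Y :: 'a \<Rightarrow>\<^sub>L 'a. Y x \<bullet> y = x \<bullet> Y y})
        \<inter> (\<Inter>T\<in>{T. commute T X}. \<Inter>x. {Y. blinfun_apply T (blinfun_apply Y x) = blinfun_apply Y (T x)})"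
      by (auto simp: K_def symmetric_def commute_def)
    also have "closed \<dots>"
      by (intro closed_Int closed_INT ballI closed_Collect_le closed_Collect_eq continuous_intros)
    finally show ?thesis .
  qed
  have maps: "f ` K \<subseteq> K"
  proof clarify
    fix Y assume Y: "Y \<in> K"
    have Ys: "symmetric Y" and Yc: "\<And>T. commute T X \<Longrightarrow> commute T Y"
      using Y by (simp_all add: K_def)
    have "norm (f Y) \<le> (norm X + norm (Y o\<^sub>L Y)) / 2"
      using norm_triangle_ineq[of X "Y o\<^sub>L Y"] by (simp add: f_def)
    also have "\<dots> \<le> (norm X + norm Y * norm Y) / 2"
      using norm_blinfun_compose[of Y Y] by simp
    also have "norm Y * norm Y \<le> 1 * q" using Y q q0 by (intro mult_mono) (auto simp: K_def)
    finally have "norm (f Y) \<le> q" using nX by simp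
    moreover have "symmetric (f Y)"
      unfolding f_def by (intro symmetric_intros X Ys) (simp add: commute_def)
    moreover have "commute T (f Y)" if "commute T X" for T
      unfolding f_def by (intro commute_intros that Yc)
    ultimately show "f Y \<in> K" by (simp add: K_def)
  qed
  have lip: "dist (f Y) (f Z) \<le> q * dist Y Z" if "Y \<in> K" "Z \<in> K" for Y Z
  proof -
    have "f Y - f Z = (1/2) *\<^sub>R ((Y o\<^sub>L (Y - Z)) + ((Y - Z) o\<^sub>L Z))"
      by (intro blinfun_eqI) (simp add: f_def blinfun.bilinear_simps algebra_simps)
    then have "norm (f Y - f Z) \<le> (norm (Y o\<^sub>L (Y - Z)) + norm ((Y - Z) o\<^sub>L Z)) / 2"
      using norm_triangle_ineq[of "Y o\<^sub>L (Y - Z)" "(Y - Z) o\<^sub>L Z"] by simp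
    also have "\<dots> \<le> (norm Y * norm (Y - Z) + norm (Y - Z) * norm Z) / 2"
      using norm_blinfun_compose[of Y "Y - Z"] norm_blinfun_compose[of "Y - Z" Z] by simp
    also have "\<dots> = norm (Y - Z) * ((norm Y + norm Z) / 2)" by (simp add: algebra_simps)
    also have "\<dots> \<le> norm (Y - Z) * q"
    proof (rule mult_left_mono)
      have "norm Y \<le> q" "norm Z \<le> q" using that by (simp_all add: K_def)
      then show "(norm Y + norm Z) / 2 \<le> q" by simp
    qed simp
    finally show ?thesis by (simp only: dist_norm mult.commute)
  qed
  have "0 \<in> K" using q0 by (simp add: K_def symmetric_def commute_def)
  then obtain Y where Y: "Y \<in> K" "f Y = Y"
    using Banach_fix[of K q f, OF _ _ q0 q maps lip] Kcl complete_eq_closed[of K] by blast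
  have "2 *\<^sub>R Y x = X x + Y (Y x)" for x
  proof -
    have "2 *\<^sub>R (f Y) x = X x + Y (Y x)" by (simp add: f_def blinfun.bilinear_simps)
    then show ?thesis by (simp only: Y(2))
  qed
  with Y(1) show ?thesis unfolding K_def by blast
qed

text \<open>
  After scaling by \<open>c = norm D + e\<close>, the operator \<open>D + e\<close> has the form \<open>1 - X\<close> with
  \<open>norm X \<le> 1 - e / c < 1\<close>.
\<close>

lemma strictly_positive_root:
  fixes D :: "'a::{real_inner,banach} \<Rightarrow>\<^sub>L 'a"
  assumes D: "pos_semidef D" and e: "0 < e"
  shows "\<exists>S. pos_semidef S \<and> (\<forall>x. S (S x) = D x + e *\<^sub>R x) \<and> (\<forall>T. commute T D \<longrightarrow> commute T S)"
proof -
  define c where "c = norm D + e"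
  define X where "X = id_blinfun - (1 / c) *\<^sub>R (D + e *\<^sub>R id_blinfun)"
  have c: "c > 0" "e \<le> c" using e by (simp_all add: c_def add_nonneg_pos)
  have Xf: "X x \<bullet> x = (norm x)\<^sup>2 - (D x \<bullet> x + e * (norm x)\<^sup>2) / c" for x
    by (simp add: X_def blinfun.bilinear_simps inner_simps power2_norm_eq_inner add_divide_distrib)
  have Xsym: "symmetric X"
    unfolding X_def by (intro symmetric_intros pos_semidefD(1) D)
  have Xpos: "pos_semidef X"
    unfolding pos_semidef_def
  proof (intro conjI allI Xsym)
    fix x
    have "D x \<bullet> x + e * (norm x)\<^sup>2 \<le> c * (norm x)\<^sup>2"
      using inner_blinfun_le[of D x] by (simp add: c_def algebra_simps)
    then show "0 \<le> X x \<bullet> x" using c by (simp add: Xf field_simps)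
  qed
  have nX: "norm X \<le> 1 - e / c"
  proof (rule positive_norm_le[OF Xpos])
    show "0 \<le> 1 - e / c" using c by simp
    show "X x \<bullet> x \<le> (1 - e / c) * (norm x)\<^sup>2" for x
      using pos_semidefD(2)[OF D, of x] c by (simp add: Xf field_simps)
  qed
  obtain Y where Y: "symmetric Y" "norm Y \<le> 1 - e / c" "\<And>T. commute T X \<Longrightarrow> commute T Y"
      "\<And>x. 2 *\<^sub>R Y x = X x + Y (Y x)"
    using contraction_root[OF Xsym nX] e c by auto
  define S where "S = sqrt c *\<^sub>R (id_blinfun - Y)"
  have "pos_semidef S"
    unfolding pos_semidef_def
  proof (intro conjI allI)
    show "symmetric S" unfolding S_def using Y by (intro symmetric_intros)
    fix x
    have "Y x \<bullet> x \<le> norm Y * (norm x)\<^sup>2" by (rule inner_blinfun_le)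
    also have "norm Y * (norm x)\<^sup>2 \<le> 1 * (norm x)\<^sup>2"
    proof (rule mult_right_mono)
      show "norm Y \<le> 1" using Y(2) divide_pos_pos[OF e c(1)] by linarith
    qed simp
    finally show "0 \<le> S x \<bullet> x"
      using c by (simp add: S_def blinfun.bilinear_simps inner_simps power2_norm_eq_inner)
  qed
  moreover have "S (S x) = D x + e *\<^sub>R x" for x
  proof -
    have "S (S x) = c *\<^sub>R (x - 2 *\<^sub>R Y x + Y (Y x))"
      using c by (simp add: S_def blinfun.bilinear_simps scaleR_2 algebra_simps)
    also have "\<dots> = c *\<^sub>R (x - X x)" by (simp add: Y(4))
    also have "\<dots> = D x + e *\<^sub>R x" using c by (simp add: X_def blinfun.bilinear_simps)
    finally show ?thesis .
  qed
  moreover have "commute T S" if "commute T D" for T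
    unfolding S_def
    by (intro commute_intros Y(3)) (simp add: X_def commute_intros that)
  ultimately show ?thesis by blast
qed

text \<open>
  Square roots depend continuously on the operator: \<open>T\<^sup>2 \<le> S\<^sup>2 \<le> (T + sqrt d)\<^sup>2\<close>, so
  \<open>T \<le> S \<le> T + sqrt d\<close> by operator monotonicity. This makes the roots of \<open>D + e\<close> a Cauchy family
  as \<open>e\<close> tends to \<open>0\<close>.
\<close>

lemma near_roots_close:
  assumes S: "pos_semidef S" and T: "pos_semidef T" and d: "0 \<le> d"
    and eq: "\<And>x. S (S x) = T (T x) + d *\<^sub>R x"
  shows "norm (S - T) \<le> sqrt d"
proof -
  have nS: "(norm (S x))\<^sup>2 = (norm (T x))\<^sup>2 + d * (norm x)\<^sup>2" for x
    using arg_cong[OF eq[of x], of "\<lambda>v. x \<bullet> v"]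
    by (simp add: power2_norm_eq_inner inner_add_right
        symmetricD[OF pos_semidefD(1)[OF S]] symmetricD[OF pos_semidefD(1)[OF T]])
  have low: "T x \<bullet> x \<le> S x \<bullet> x" for x
  proof (rule form_le_of_norm_le[OF pos_semidefD(1)[OF T] S])
    show "norm (T x) \<le> norm (S x)" for x
      by (rule power2_le_imp_le) (use nS[of x] d in auto)
  qed
  define U where "U = T + sqrt d *\<^sub>R id_blinfun"
  have U: "pos_semidef U" unfolding pos_semidef_def
    using T d by (auto simp: U_def pos_semidefD blinfun.bilinear_simps inner_simps intro!: symmetric_intros)
  have up: "S x \<bullet> x \<le> U x \<bullet> x" for x
  proof (rule form_le_of_norm_le[OF pos_semidefD(1)[OF S] U])
    fix x
    have "(norm (U x))\<^sup>2 = (norm (T x))\<^sup>2 + 2 * sqrt d * (T x \<bullet> x) + d * (norm x)\<^sup>2"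
      using d by (simp add: U_def blinfun.bilinear_simps inner_simps power2_norm_eq_inner
          inner_commute algebra_simps)
    then have "(norm (S x))\<^sup>2 \<le> (norm (U x))\<^sup>2"
      using nS[of x] pos_semidefD(2)[OF T, of x] d by simp
    then show "norm (S x) \<le> norm (U x)" by (rule power2_le_imp_le) simp
  qed
  show ?thesis
  proof (rule positive_norm_le)
    show "pos_semidef (S - T)" unfolding pos_semidef_def
      using low S T by (auto simp: pos_semidefD blinfun.bilinear_simps inner_simps intro!: symmetric_intros)
    show "(S - T) x \<bullet> x \<le> sqrt d * (norm x)\<^sup>2" for x
      using up[of x] by (simp add: U_def blinfun.bilinear_simps inner_simps power2_norm_eq_inner)
  qed (use d in simp)
qed

lemma positive_root_exists:
  fixes D :: "'a::{real_inner,banach} \<Rightarrow>\<^sub>L 'a"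
  assumes D: "pos_semidef D"
  shows "\<exists>S. pos_semidef S \<and> (\<forall>x. S (S x) = D x) \<and> (\<forall>T. commute T D \<longrightarrow> commute T S)"
proof -
  define e where "e n = inverse (real (Suc n))" for n
  have "\<forall>n. \<exists>S. pos_semidef S \<and> (\<forall>x. S (S x) = D x + e n *\<^sub>R x) \<and> (\<forall>T. commute T D \<longrightarrow> commute T S)"
    using strictly_positive_root[OF D] by (simp add: e_def)
  then obtain s where s: "\<And>n. pos_semidef (s n)" "\<And>n x. s n (s n x) = D x + e n *\<^sub>R x"
      "\<And>n T. commute T D \<Longrightarrow> commute T (s n)"
    by metis
  have close: "norm (s m - s n) \<le> sqrt (e m)" if "m \<le> n" for m n
  proof -
    have le: "e n \<le> e m" using that by (simp add: e_def field_simps)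
    have "norm (s m - s n) \<le> sqrt (e m - e n)"
      using le by (intro near_roots_close s(1)) (auto simp: s(2) algebra_simps)
    also have "\<dots> \<le> sqrt (e m)" by (simp add: e_def)
    finally show ?thesis .
  qed
  have e0: "e \<longlonglongrightarrow> 0" unfolding e_def by (rule LIMSEQ_inverse_real_of_nat)
  have "Cauchy s"
  proof (rule metric_CauchyI)
    fix r :: real assume r: "r > 0"
    have "(\<lambda>n. sqrt (e n)) \<longlonglongrightarrow> sqrt 0" by (intro tendsto_intros e0)
    then have "eventually (\<lambda>n. sqrt (e n) < r) sequentially"
      using r by (intro order_tendstoD) auto
    then obtain N where N: "\<And>n. n \<ge> N \<Longrightarrow> sqrt (e n) < r" by (auto simp: eventually_sequentially)
    show "\<exists>M. \<forall>m\<ge>M. \<forall>n\<ge>M. dist (s m) (s n) < r"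
    proof (intro exI[of _ N] allI impI)
      fix m n assume "m \<ge> N" "n \<ge> N"
      then show "dist (s m) (s n) < r"
        using close[of m n] close[of n m] N[of m] N[of n]
        by (cases "m \<le> n") (auto simp: dist_norm norm_minus_commute)
    qed
  qed
  then obtain S where S: "s \<longlonglongrightarrow> S" using Cauchy_convergent_iff convergent_def by blast
  have app: "(\<lambda>n. s n x) \<longlonglongrightarrow> S x" for x by (intro tendsto_intros S)
  have "pos_semidef S" unfolding pos_semidef_def symmetric_def
  proof (intro conjI allI)
    fix x y
    have "(\<lambda>n. s n x \<bullet> y) \<longlonglongrightarrow> S x \<bullet> y" by (intro tendsto_intros app)
    moreover have "(\<lambda>n. s n x \<bullet> y) \<longlonglongrightarrow> x \<bullet> S y"
      unfolding symmetricD[OF pos_semidefD(1)[OF s(1)]] by (intro tendsto_intros app)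
    ultimately show "S x \<bullet> y = x \<bullet> S y" by (rule LIMSEQ_unique)
    have "(\<lambda>n. s n x \<bullet> x) \<longlonglongrightarrow> S x \<bullet> x" by (intro tendsto_intros app)
    then show "0 \<le> S x \<bullet> x" by (rule LIMSEQ_le_const) (auto intro: pos_semidefD s)
  qed
  moreover have "S (S x) = D x" for x
  proof -
    have "(\<lambda>n. s n (s n x)) \<longlonglongrightarrow> S (S x)" by (intro tendsto_intros S)
    moreover have "(\<lambda>n. s n (s n x)) \<longlonglongrightarrow> D x + 0 *\<^sub>R x"
      unfolding s(2) by (intro tendsto_intros e0)
    ultimately show ?thesis using LIMSEQ_unique by fastforce
  qed
  moreover have "commute T S" if "commute T D" for T
    unfolding commute_def
  proof
    fix x
    have "(\<lambda>n. T (s n x)) \<longlonglongrightarrow> T (S x)" by (intro tendsto_intros app)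
    moreover have "(\<lambda>n. T (s n x)) \<longlonglongrightarrow> S (T x)"
      unfolding commuteD[OF s(3)[OF that]] by (rule app)
    ultimately show "T (S x) = S (T x)" by (rule LIMSEQ_unique)
  qed
  ultimately show ?thesis by blast
qed

section \<open>Orthogonal projections and adjoints\<close>

lemma power2_norm_add_scaleR:
  fixes w m :: "'a::real_inner"
  shows "(norm (w + t *\<^sub>R m))\<^sup>2 = (norm w)\<^sup>2 + 2 * t * (w \<bullet> m) + t\<^sup>2 * (m \<bullet> m)"
  unfolding power2_norm_eq_inner inner_add_left inner_add_right inner_commute[of "t *\<^sub>R m" w]
  by (simp add: power2_eq_square)

text \<open>
  The component in \<open>M\<close> is the nearest point of \<open>M\<close>: a minimizing sequence is Cauchy by the
  parallelogram law, and minimality gives orthogonality.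
\<close>

lemma orthogonal_decomposition:
  fixes M :: "'a::{real_inner,banach} set"
  assumes M: "subspace M" "closed M"
  obtains p q where "x = p + q" "p \<in> M" "\<And>m. m \<in> M \<Longrightarrow> q \<bullet> m = 0"
proof -
  define d where "d = Inf ((\<lambda>m. (norm (x - m))\<^sup>2) ` M)"
  have M0: "0 \<in> M" by (rule subspace_0[OF M(1)])
  have bdd: "bdd_below ((\<lambda>m. (norm (x - m))\<^sup>2) ` M)" by (rule bdd_belowI2[of _ 0]) simp
  have d_le: "d \<le> (norm (x - m))\<^sup>2" if "m \<in> M" for m
    unfolding d_def by (rule cINF_lower[OF bdd that])
  have "\<exists>m\<in>M. (norm (x - m))\<^sup>2 < d + inverse (real (Suc n))" for n
  proof -
    have "d < d + inverse (real (Suc n))" by simp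
    then show ?thesis
      unfolding d_def using cInf_lessD[of "(\<lambda>m. (norm (x - m))\<^sup>2) ` M"] M0 by blast
  qed
  then obtain s where s: "\<And>n. s n \<in> M" "\<And>n. (norm (x - s n))\<^sup>2 < d + inverse (real (Suc n))"
    by metis
  have close: "(norm (s m - s n))\<^sup>2 \<le> 4 * inverse (real (Suc k))" if "k \<le> m" "k \<le> n" for k m n
  proof -
    have "(1/2) *\<^sub>R (s m + s n) \<in> M" using M(1) s by (intro subspace_scale subspace_add)
    from d_le[OF this] have "4 * d \<le> 4 * (norm (x - (1/2) *\<^sub>R (s m + s n)))\<^sup>2" by simp
    moreover have "(norm (s m - s n))\<^sup>2 + 4 * (norm (x - (1/2) *\<^sub>R (s m + s n)))\<^sup>2
        = 2 * (norm (x - s m))\<^sup>2 + 2 * (norm (x - s n))\<^sup>2"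
      by (simp add: power2_norm_eq_inner inner_simps inner_commute algebra_simps)
    moreover have "inverse (real (Suc m)) \<le> inverse (real (Suc k))"
        "inverse (real (Suc n)) \<le> inverse (real (Suc k))"
      using that by (auto intro!: le_imp_inverse_le)
    ultimately show ?thesis using s(2)[of m] s(2)[of n] by linarith
  qed
  have i0: "(\<lambda>n. inverse (real (Suc n))) \<longlonglongrightarrow> 0" by (rule LIMSEQ_inverse_real_of_nat)
  have "Cauchy s"
  proof (rule metric_CauchyI)
    fix r :: real assume r: "r > 0"
    have "eventually (\<lambda>n. inverse (real (Suc n)) < r\<^sup>2 / 4) sequentially"
      using r by (intro order_tendstoD[OF i0]) simp
    then obtain N where N: "inverse (real (Suc N)) < r\<^sup>2 / 4" by (auto simp: eventually_sequentially)
    show "\<exists>N. \<forall>m\<ge>N. \<forall>n\<ge>N. dist (s m) (s n) < r"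
    proof (intro exI[of _ N] allI impI)
      fix m n assume "m \<ge> N" "n \<ge> N"
      then have "(norm (s m - s n))\<^sup>2 < r\<^sup>2" using close[of N m n] N by linarith
      then show "dist (s m) (s n) < r" using r by (simp add: dist_norm power_less_imp_less_base)
    qed
  qed
  then obtain p where p: "s \<longlonglongrightarrow> p" using Cauchy_convergent_iff convergent_def by blast
  have pM: "p \<in> M" using M(2) s(1) p by (rule closed_sequentially)
  have nd: "(norm (x - p))\<^sup>2 \<le> d"
  proof (rule tendsto_le[OF trivial_limit_sequentially])
    show "(\<lambda>n. d + inverse (real (Suc n))) \<longlonglongrightarrow> d" using tendsto_add[OF tendsto_const i0, of d] by simp
    show "(\<lambda>n. (norm (x - s n))\<^sup>2) \<longlonglongrightarrow> (norm (x - p))\<^sup>2" by (intro tendsto_intros p)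
  qed (use s(2) in \<open>auto intro!: always_eventually less_imp_le simp del: of_nat_Suc\<close>)
  have "(x - p) \<bullet> m = 0" if m: "m \<in> M" for m
  proof -
    have "((x - p) \<bullet> m)\<^sup>2 \<le> 0 * (m \<bullet> m)"
    proof (rule nonneg_quadratic_discriminant)
      fix t
      have "p - t *\<^sub>R m \<in> M" using M(1) pM m by (intro subspace_diff subspace_scale)
      from nd d_le[OF this] have le: "(norm (x - p))\<^sup>2 \<le> (norm (x - (p - t *\<^sub>R m)))\<^sup>2"
        by (rule order_trans)
      have eq: "x - (p - t *\<^sub>R m) = (x - p) + t *\<^sub>R m" by simp
      from le show "0 \<le> 0 + 2 * t * ((x - p) \<bullet> m) + t\<^sup>2 * (m \<bullet> m)"
        unfolding eq power2_norm_add_scaleR by linarith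
    qed simp
    then show ?thesis by simp
  qed
  with pM show thesis by (intro that[of p "x - p"]) auto
qed

lemma Riesz_representation:
  fixes f :: "'a::{real_inner,banach} \<Rightarrow> real"
  assumes "bounded_linear f"
  obtains z where "\<And>x. f x = x \<bullet> z"
proof -
  interpret f: bounded_linear f by fact
  define M where "M = {x. f x = 0}"
  have "subspace M" by (auto simp: M_def subspace_def f.zero f.add f.scaleR)
  moreover have "closed M"
    unfolding M_def by (intro closed_Collect_eq continuous_intros f.continuous_on)
  ultimately have dec: "\<exists>p q. x = p + q \<and> p \<in> M \<and> (\<forall>m\<in>M. q \<bullet> m = 0)" for x
    by (metis orthogonal_decomposition)
  show thesis
  proof (cases "\<forall>x. f x = 0")
    case True
    then show thesis by (intro that[of 0]) simp
  next
    case False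
    then obtain x where "f x \<noteq> 0" by blast
    obtain p q where pq: "x = p + q" "p \<in> M" "\<And>m. m \<in> M \<Longrightarrow> q \<bullet> m = 0" using dec by metis
    have fq: "f q \<noteq> 0" using \<open>f x \<noteq> 0\<close> pq by (simp add: M_def f.add)
    have qq: "q \<bullet> q \<noteq> 0" using fq by (auto simp: f.zero)
    have "f y = y \<bullet> ((f q / (q \<bullet> q)) *\<^sub>R q)" for y
    proof -
      have "y - (f y / f q) *\<^sub>R q \<in> M" using fq by (simp add: M_def f.diff f.scaleR)
      from pq(3)[OF this] have "q \<bullet> y = (f y / f q) * (q \<bullet> q)" by (simp add: inner_diff_right)
      then have "y \<bullet> ((f q / (q \<bullet> q)) *\<^sub>R q) = (f q / (q \<bullet> q)) * ((f y / f q) * (q \<bullet> q))"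
        by (simp only: inner_scaleR_right inner_commute[of y q])
      also have "\<dots> = f y" using fq qq by simp
      finally show ?thesis by simp
    qed
    then show thesis by (rule that)
  qed
qed

lemma adjoint_exists:
  fixes T :: "'a::{real_inner,banach} \<Rightarrow>\<^sub>L 'a"
  obtains S :: "'a \<Rightarrow>\<^sub>L 'a" where "\<And>x y. T x \<bullet> y = x \<bullet> S y"
proof -
  have "\<exists>z. \<forall>x. T x \<bullet> y = x \<bullet> z" for y
  proof -
    have "bounded_linear (\<lambda>x. T x \<bullet> y)"
      by (intro bounded_linear_compose[OF bounded_linear_inner_left] blinfun.bounded_linear_right)
    then show ?thesis by (rule Riesz_representation) blast
  qed
  then obtain g where g: "\<And>x y. T x \<bullet> y = x \<bullet> g y" by metis
  have "bounded_linear g"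
  proof (rule bounded_linear_intro)
    show "g (y + z) = g y + g z" for y z
      by (rule vector_eq_ldot[THEN iffD1]) (simp add: inner_add_right flip: g)
    show "g (r *\<^sub>R y) = r *\<^sub>R g y" for r y
      by (rule vector_eq_ldot[THEN iffD1]) (simp flip: g)
    show "norm (g y) \<le> norm y * norm T" for y
    proof (cases "g y = 0")
      case False
      have "norm (g y) * norm (g y) = T (g y) \<bullet> y" by (simp add: g flip: power2_norm_eq_inner power2_eq_square)
      also have "\<dots> \<le> norm (T (g y)) * norm y" by (rule norm_cauchy_schwarz)
      also have "\<dots> \<le> (norm T * norm (g y)) * norm y" by (intro mult_right_mono norm_blinfun) simp
      finally have "norm (g y) * norm (g y) \<le> (norm y * norm T) * norm (g y)" by (simp add: ac_simps)
      then show ?thesis by (rule mult_right_le_imp_le) (use False in simp)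
    qed simp
  qed
  then show thesis using g by (intro that[of "Blinfun g"]) (simp add: bounded_linear_Blinfun_apply)
qed

section \<open>Spectral subspaces of a positive operator\<close>

text \<open>
  The operator \<open>F = (|S| + S) / 2\<close>, characterised by what is used of it: the second condition is
  \<open>S\<^sup>+ S\<^sup>- = 0\<close>, since \<open>F - S\<close> is the negative part.
\<close>

definition pos_part :: "('a::{real_inner,banach} \<Rightarrow>\<^sub>L 'a) \<Rightarrow> ('a \<Rightarrow>\<^sub>L 'a)" where
  "pos_part S = (SOME F. pos_semidef F \<and> (\<forall>x. F (F x) = F (S x)) \<and> pos_semidef (F - S) \<and>
     (\<forall>T. commute T S \<longrightarrow> commute T F))"

lemma pos_part:
  fixes S :: "'a::{real_inner,banach} \<Rightarrow>\<^sub>L 'a"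
  assumes S: "symmetric S"
  shows "pos_semidef (pos_part S)" "pos_part S (pos_part S x) = pos_part S (S x)"
    "pos_semidef (pos_part S - S)" "commute T S \<Longrightarrow> commute T (pos_part S)"
proof -
  have SS: "pos_semidef (S o\<^sub>L S)"
    unfolding pos_semidef_def
  proof (intro conjI allI)
    show "symmetric (S o\<^sub>L S)" by (intro symmetric_intros S) (simp add: commute_def)
    show "0 \<le> (S o\<^sub>L S) x \<bullet> x" for x
      by (simp add: symmetricD[OF S, of "S x" x])
  qed
  obtain Q where Q: "pos_semidef Q" "\<And>x. Q (Q x) = S (S x)" "\<And>T. commute T (S o\<^sub>L S) \<Longrightarrow> commute T Q"
    using positive_root_exists[OF SS] by auto
  have QS: "Q (S x) = S (Q x)" for x
    using commuteD[OF Q(3)[of S]] by (simp add: commute_def)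
  have nrm: "norm (Q x) = norm (S x)" for x
    using arg_cong[OF Q(2)[of x], of "\<lambda>v. x \<bullet> v"]
    by (simp only: norm_eq symmetricD[OF S] symmetricD[OF pos_semidefD(1)[OF Q(1)]])
  have le: "S x \<bullet> x \<le> Q x \<bullet> x" "(- S) x \<bullet> x \<le> Q x \<bullet> x" for x
    by (rule form_le_of_norm_le[OF _ Q(1)]; simp add: symmetric_intros(4) S nrm blinfun.minus_left)+
  define F where "F = (1/2) *\<^sub>R (Q + S)"
  have FS: "F - S = (1/2) *\<^sub>R (Q - S)"
  proof -
    have "2 *\<^sub>R (F - S) = Q - S" by (simp add: F_def scaleR_diff_right scaleR_2)
    then show ?thesis by (metis scaleR_half_double scaleR_2 scaleR_scaleR scaleR_add_right)
  qed
  note sQ = pos_semidefD(1)[OF Q(1)]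
  have "symmetric F" unfolding F_def by (intro symmetric_intros sQ S)
  moreover have "0 \<le> Q x \<bullet> x + S x \<bullet> x" for x using le(2)[of x] by (simp add: blinfun.minus_left)
  ultimately have "pos_semidef F"
    by (simp add: pos_semidef_def F_def blinfun.bilinear_simps inner_simps)
  moreover have "F (F x) = F (S x)" for x
  proof -
    have "4 *\<^sub>R F (F x) = 2 *\<^sub>R (S (S x) + S (Q x))"
      by (simp add: F_def blinfun.add_left blinfun.add_right blinfun.scaleR_left blinfun.scaleR_right
          Q(2) QS add.commute flip: scaleR_2)
    also have "\<dots> = 4 *\<^sub>R F (S x)"
      by (simp add: F_def blinfun.bilinear_simps QS add.commute)
    finally show ?thesis by simp
  qed
  moreover have "symmetric (F - S)" unfolding FS by (intro symmetric_intros sQ S)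
  then have "pos_semidef (F - S)"
    using le(1) by (simp add: FS pos_semidef_def blinfun.bilinear_simps inner_simps)
  moreover have "commute T F" if "commute T S" for T
    unfolding F_def by (intro commute_intros Q(3) that)
  ultimately have "\<exists>F. pos_semidef F \<and> (\<forall>x. F (F x) = F (S x)) \<and> pos_semidef (F - S) \<and>
     (\<forall>T. commute T S \<longrightarrow> commute T F)" by blast
  from someI_ex[OF this] show "pos_semidef (pos_part S)" "pos_part S (pos_part S x) = pos_part S (S x)"
    "pos_semidef (pos_part S - S)" "commute T S \<Longrightarrow> commute T (pos_part S)"
    unfolding pos_part_def[symmetric] by auto
qed

definition excess :: "('a::{real_inner,banach} \<Rightarrow>\<^sub>L 'a) \<Rightarrow> real \<Rightarrow> ('a \<Rightarrow>\<^sub>L 'a)" where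
  "excess D r = pos_part (D - r *\<^sub>R id_blinfun)"

text \<open>
  For positive \<open>D\<close> and \<open>r \<ge> 0\<close>, the range of the spectral projection of \<open>D\<close> for \<open>[0, r]\<close>.
\<close>

definition spectral_subspace :: "('a::{real_inner,banach} \<Rightarrow>\<^sub>L 'a) \<Rightarrow> real \<Rightarrow> 'a set" where
  "spectral_subspace D r = {x. excess D r x = 0}"

lemma excess:
  assumes "symmetric D"
  shows "pos_semidef (excess D r)" "excess D r (excess D r x) = excess D r (D x - r *\<^sub>R x)"
    "D x \<bullet> x - r * (norm x)\<^sup>2 \<le> excess D r x \<bullet> x"
    "commute T D \<Longrightarrow> commute T (excess D r)"
proof -
  have S: "symmetric (D - r *\<^sub>R id_blinfun)" by (intro symmetric_intros assms)
  show "pos_semidef (excess D r)" "excess D r (excess D r x) = excess D r (D x - r *\<^sub>R x)"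
    using pos_part(1,2)[OF S] by (simp_all add: excess_def blinfun.bilinear_simps)
  show "D x \<bullet> x - r * (norm x)\<^sup>2 \<le> excess D r x \<bullet> x"
    using pos_semidefD(2)[OF pos_part(3)[OF S], of x]
    by (simp add: excess_def blinfun.bilinear_simps inner_simps power2_norm_eq_inner)
  show "commute T (excess D r)" if "commute T D"
    unfolding excess_def by (intro pos_part(4)[OF S] commute_intros that)
qed

lemma excess_commute:
  assumes "symmetric D"
  shows "excess D r (D x) = D (excess D r x)" "excess D r (excess D s x) = excess D s (excess D r x)"
proof -
  have "commute D D" by (simp add: commute_def)
  then have c: "commute D (excess D r)" for r by (rule excess(4)[OF assms])
  then show "excess D r (D x) = D (excess D r x)" by (simp add: commute_def)
  have "commute (excess D s) (excess D r)" by (intro excess(4)[OF assms] commute_sym[OF c])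
  then show "excess D r (excess D s x) = excess D s (excess D r x)" by (simp add: commute_def)
qed

lemma subspace_spectral_subspace: "subspace (spectral_subspace D r)"
  by (auto simp: spectral_subspace_def subspace_def blinfun.bilinear_simps)

lemma closed_spectral_subspace: "closed (spectral_subspace D r)"
  unfolding spectral_subspace_def by (intro closed_Collect_eq continuous_intros)

lemma spectral_subspace_invariant:
  assumes "symmetric D" "x \<in> spectral_subspace D r"
  shows "D x \<in> spectral_subspace D r" "excess D s x \<in> spectral_subspace D r"
  using assms excess_commute[OF assms(1), of r] by (simp_all add: spectral_subspace_def)

lemma form_le_on_spectral_subspace:
  assumes "symmetric D" "x \<in> spectral_subspace D r"
  shows "D x \<bullet> x \<le> r * (norm x)\<^sup>2"
  using excess(3)[OF assms(1), of x r] assms(2) by (simp add: spectral_subspace_def)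

lemma norm_power_le_on_spectral_subspace:
  assumes D: "pos_semidef D" and r: "0 \<le> r" and x: "x \<in> spectral_subspace D r"
  shows "norm ((blinfun_apply D ^^ n) x) \<le> r ^ n * norm x"
  using x
proof (induction n arbitrary: x)
  case (Suc n)
  note sD = pos_semidefD(1)[OF D]
  note inv = spectral_subspace_invariant(1)[OF sD Suc.prems]
  have "norm ((blinfun_apply D ^^ Suc n) x) \<le> r ^ n * norm (D x)"
    using Suc.IH[OF inv] by (simp add: funpow_swap1)
  also have "\<dots> \<le> r ^ n * (r * norm x)"
    using r by (intro mult_left_mono positive_norm_le_local[OF D]
        form_le_on_spectral_subspace[OF sD] Suc.prems inv) auto
  finally show ?case by (simp add: ac_simps)
qed simp

text \<open>
  Converse to the preceding bound. Let \<open>F = (D - r)\<^sup>+\<close>. On the range of \<open>F\<close> one has \<open>D = r + F\<close>,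
  so for \<open>u n = D\<^sup>n (F x)\<close> the square norm gains at least \<open>r\<^bsup>2n\<^esup> (norm (F (F x)))\<^sup>2\<close> beyond the factor
  \<open>r\<^sup>2\<close> at every step. For \<open>r > 0\<close> it therefore grows at least linearly relative to \<open>r\<^bsup>2n\<^esup>\<close>
  unless \<open>F (F x) = 0\<close>, that is unless \<open>F x = 0\<close>; for \<open>r = 0\<close> the bound at \<open>n = 1\<close> suffices.
\<close>

lemma spectral_subspaceI_growth:
  assumes D: "pos_semidef D" and r: "0 \<le> r" and growth: "\<And>n. norm ((blinfun_apply D ^^ n) x) \<le> C * r ^ n"
  shows "x \<in> spectral_subspace D r"
proof -
  define F where "F = excess D r"
  note sD = pos_semidefD(1)[OF D]
  have F: "pos_semidef F" unfolding F_def by (rule excess(1)[OF sD])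
  note sF = symmetricD[OF pos_semidefD(1)[OF F]]
  have FD: "F (D y) = D (F y)" for y unfolding F_def by (rule excess_commute[OF sD])
  have FDn: "F ((blinfun_apply D ^^ n) y) = (blinfun_apply D ^^ n) (F y)" for n y by (induction n) (simp_all add: FD)
  have DF: "D (F y) = r *\<^sub>R F y + F (F y)" for y
    using excess(2)[OF sD, of r y] by (simp add: F_def blinfun.bilinear_simps FD[unfolded F_def])
  define u where "u n = (blinfun_apply D ^^ n) (F x)" for n
  have Du: "u (Suc n) = r *\<^sub>R u n + F (u n)" for n
    using DF[of "(blinfun_apply D ^^ n) x"] by (simp add: u_def FDn)
  have Fu: "r ^ n * norm (F (F x)) \<le> norm (F (u n))" for n
  proof (induction n)
    case (Suc n)
    have "r * norm (F (u n)) \<le> norm (F (u (Suc n)))"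
    proof (rule power2_le_imp_le)
      have "F (u (Suc n)) = F (F (u n)) + r *\<^sub>R F (u n)"
        by (simp add: Du blinfun.bilinear_simps)
      then have "(norm (F (u (Suc n))))\<^sup>2 = (r * norm (F (u n)))\<^sup>2 + 2 * r * (F (F (u n)) \<bullet> F (u n))
          + (norm (F (F (u n))))\<^sup>2"
        by (simp only: power2_norm_add_scaleR) (simp add: power2_norm_eq_inner power_mult_distrib)
      then show "(r * norm (F (u n)))\<^sup>2 \<le> (norm (F (u (Suc n))))\<^sup>2"
        using r pos_semidefD(2)[OF F, of "F (u n)"] by simp
    qed simp
    moreover have "r ^ Suc n * norm (F (F x)) \<le> r * norm (F (u n))"
      using mult_left_mono[OF Suc r] by (simp add: ac_simps)
    ultimately show ?case by linarith
  qed (simp add: u_def)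
  have low: "real n * (r ^ n * norm (F (F x)))\<^sup>2 \<le> r\<^sup>2 * (norm (u n))\<^sup>2" for n
  proof (induction n)
    case (Suc n)
    have "u (Suc n) = F (u n) + r *\<^sub>R u n" by (simp add: Du)
    then have "(norm (u (Suc n)))\<^sup>2 = r\<^sup>2 * (norm (u n))\<^sup>2 + 2 * r * (F (u n) \<bullet> u n) + (norm (F (u n)))\<^sup>2"
      by (simp only: power2_norm_add_scaleR) (simp add: power2_norm_eq_inner)
    moreover have "(r ^ n * norm (F (F x)))\<^sup>2 \<le> (norm (F (u n)))\<^sup>2" using Fu[of n] r by (intro power_mono) auto
    ultimately have "real n * (r ^ n * norm (F (F x)))\<^sup>2 + (r ^ n * norm (F (F x)))\<^sup>2 \<le> (norm (u (Suc n)))\<^sup>2"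
      using Suc r pos_semidefD(2)[OF F, of "u n"] by (smt (verit) mult_nonneg_nonneg)
    then have "r\<^sup>2 * (real n * (r ^ n * norm (F (F x)))\<^sup>2 + (r ^ n * norm (F (F x)))\<^sup>2) \<le> r\<^sup>2 * (norm (u (Suc n)))\<^sup>2"
      by (rule mult_left_mono) simp
    then show ?case by (simp add: algebra_simps power_mult_distrib power2_eq_square)
  qed simp
  have up: "norm (u n) \<le> norm F * C * r ^ n" for n
  proof -
    have "norm (u n) \<le> norm F * norm ((blinfun_apply D ^^ n) x)" unfolding u_def FDn[symmetric] by (rule norm_blinfun)
    also have "\<dots> \<le> norm F * (C * r ^ n)" by (intro mult_left_mono growth) simp
    finally show ?thesis by (simp add: mult.assoc)
  qed
  have FFx: "F (F x) = 0"
  proof (cases "r = 0")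
    case True
    have "u 1 = 0" using up[of 1] True by simp
    then show ?thesis using Du[of 0] True by (simp add: u_def)
  next
    case False
    define K where "K = r\<^sup>2 * (norm F * C)\<^sup>2"
    have "real n * (norm (F (F x)))\<^sup>2 \<le> K" for n
    proof -
      have "(norm (u n))\<^sup>2 \<le> (norm F * C * r ^ n)\<^sup>2" using up[of n] by (intro power_mono) auto
      then have "r\<^sup>2 * (norm (u n))\<^sup>2 \<le> r\<^sup>2 * (norm F * C * r ^ n)\<^sup>2" by (rule mult_left_mono) simp
      with low[of n] have "(real n * (norm (F (F x)))\<^sup>2) * (r ^ n)\<^sup>2 \<le> K * (r ^ n)\<^sup>2"
        by (simp add: K_def power_mult_distrib ac_simps)
      then show ?thesis by (rule mult_right_le_imp_le) (use False in simp)
    qed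
    then have "(norm (F (F x)))\<^sup>2 \<le> 0"
      by (metis linorder_not_less reals_Archimedean3)
    then show ?thesis by simp
  qed
  have "F x \<bullet> F x = x \<bullet> F (F x)" by (rule sF)
  then have "F x = 0" using FFx by simp
  then show ?thesis by (simp add: spectral_subspace_def F_def)
qed

lemma spectral_subspace_mono:
  assumes D: "pos_semidef D" and "0 \<le> r" "r \<le> s"
  shows "spectral_subspace D r \<subseteq> spectral_subspace D s"
proof
  fix x assume "x \<in> spectral_subspace D r"
  note g = norm_power_le_on_spectral_subspace[OF D \<open>0 \<le> r\<close> this]
  show "x \<in> spectral_subspace D s"
  proof (rule spectral_subspaceI_growth[OF D])
    show "norm ((blinfun_apply D ^^ n) x) \<le> norm x * s ^ n" for n
    proof -
      have "r ^ n * norm x \<le> s ^ n * norm x" using assms by (intro mult_right_mono power_mono) auto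
      with g[of n] show ?thesis by (simp add: ac_simps)
    qed
  qed (use assms in simp)
qed

lemma spectral_subspace_top:
  assumes D: "pos_semidef D" and "norm D \<le> r"
  shows "x \<in> spectral_subspace D r"
proof -
  have r: "0 \<le> r" using assms norm_ge_zero[of D] by linarith
  have "norm ((blinfun_apply D ^^ n) x) \<le> norm x * r ^ n" for n
  proof (induction n)
    case (Suc n)
    have "norm ((blinfun_apply D ^^ Suc n) x) \<le> norm D * norm ((blinfun_apply D ^^ n) x)" by (simp add: norm_blinfun)
    also have "\<dots> \<le> r * (norm x * r ^ n)" using assms Suc r by (intro mult_mono) auto
    finally show ?case by (simp add: ac_simps)
  qed simp
  then show ?thesis by (rule spectral_subspaceI_growth[OF D r])
qed

text \<open>
  Orthogonally to the kernel of \<open>F = (D - r)\<^sup>+\<close> the negative part \<open>G\<close> of \<open>D - r\<close> vanishes: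
  \<open>F G = 0\<close> puts the range of \<open>G\<close> inside that kernel, so \<open>(norm (G q))\<^sup>2 = q \<bullet> G (G q) = 0\<close>.
\<close>

lemma excess_on_orthogonal_complement:
  assumes D: "symmetric D" and q: "\<And>m. m \<in> spectral_subspace D r \<Longrightarrow> q \<bullet> m = 0"
  shows "excess D r q = D q - r *\<^sub>R q"
proof -
  define F where "F = excess D r"
  define G where "G = F - (D - r *\<^sub>R id_blinfun)"
  have sF: "symmetric F" unfolding F_def by (rule pos_semidefD(1)[OF excess(1)[OF D]])
  have G: "symmetric G" unfolding G_def by (intro symmetric_intros sF D)
  have FG: "F (G x) = 0" for x
    using excess(2)[OF D, of r x] by (simp add: F_def G_def blinfun.bilinear_simps)
  have "q \<bullet> G (G q) = 0" by (rule q) (use FG in \<open>simp add: spectral_subspace_def F_def\<close>)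
  then have "G q = 0" using symmetricD[OF G, of q "G q"] by simp
  then show ?thesis by (simp add: G_def F_def blinfun.bilinear_simps)
qed


text \<open>
  Vectors in the spectral subspace for \<open>(r, r + d]\<close> are eigenvectors of \<open>D\<close> up to an error of
  relative size \<open>d\<close>.
\<close>

lemma spectral_localization:
  assumes D: "symmetric D" and "0 \<le> d"
    and q: "q \<in> spectral_subspace D (r + d)" "\<And>m. m \<in> spectral_subspace D r \<Longrightarrow> q \<bullet> m = 0"
  shows "norm (D q - r *\<^sub>R q) \<le> d * norm q"
proof -
  define F where "F = excess D r"
  have F: "pos_semidef F" unfolding F_def by (rule excess(1)[OF D])
  have Fq: "F q = D q - r *\<^sub>R q" unfolding F_def by (rule excess_on_orthogonal_complement[OF D q(2)])
  have FFq: "F (F q) = D (F q) - r *\<^sub>R F q"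
    using excess(2)[OF D, of r q] excess_commute(1)[OF D, of r q]
    by (simp add: F_def blinfun.bilinear_simps)
  have le: "F y \<bullet> y \<le> d * (norm y)\<^sup>2"
    if "F y = D y - r *\<^sub>R y" "y \<in> spectral_subspace D (r + d)" for y
    using form_le_on_spectral_subspace[OF D that(2)] unfolding that(1)
    by (simp add: inner_diff_left power2_norm_eq_inner distrib_right)
  have "F q \<in> spectral_subspace D (r + d)"
    unfolding F_def by (rule spectral_subspace_invariant(2)[OF D q(1)])
  then have "norm (F q) \<le> d * norm q"
    by (intro positive_norm_le_local[OF F \<open>0 \<le> d\<close>] le Fq FFq q(1))
  then show ?thesis by (simp add: Fq)
qed

text \<open>
  The growth bounds make every spectral subspace of \<open>D\<close> invariant under \<open>B\<close> and its adjoint, hence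
  \<open>B\<close> preserves both it and its orthogonal complement. The commutator \<open>C\<close> of \<open>D\<close> and \<open>B\<close> is then
  block diagonal with respect to any partition of the spectrum. Over an interval of length \<open>d\<close> its
  norm is at most \<open>2 * norm B * d\<close>, and by Pythagoras the same bound holds for finitely many
  adjacent intervals together; the induction over \<open>n\<close> adds one interval at a time.
\<close>

lemma commute_if_growth_bounds:
  fixes D B B' :: "'a::{real_inner,banach} \<Rightarrow>\<^sub>L 'a"
  assumes D: "pos_semidef D" and adj: "\<And>x y. B x \<bullet> y = x \<bullet> B' y"
    and gB: "\<And>n x. norm ((blinfun_apply D ^^ n) (B x)) \<le> b * norm ((blinfun_apply D ^^ n) x)"
    and gB': "\<And>n x. norm ((blinfun_apply D ^^ n) (B' x)) \<le> b' * norm ((blinfun_apply D ^^ n) x)"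
    and b: "0 \<le> b" "0 \<le> b'"
  shows "commute D B"
proof -
  let ?N = "spectral_subspace D"
  note sD = pos_semidefD(1)[OF D]
  have inv: "T x \<in> ?N r"
    if "0 \<le> r" "x \<in> ?N r" "0 \<le> c" "\<And>n x. norm ((blinfun_apply D ^^ n) (T x)) \<le> c * norm ((blinfun_apply D ^^ n) x)"
    for T :: "'a \<Rightarrow>\<^sub>L 'a" and r c x
  proof (rule spectral_subspaceI_growth[OF D \<open>0 \<le> r\<close>])
    fix n
    have "norm ((blinfun_apply D ^^ n) (T x)) \<le> c * norm ((blinfun_apply D ^^ n) x)" by (rule that)
    also have "\<dots> \<le> c * (r ^ n * norm x)"
      using that by (intro mult_left_mono norm_power_le_on_spectral_subspace[OF D]) auto
    finally show "norm ((blinfun_apply D ^^ n) (T x)) \<le> (c * norm x) * r ^ n" by (simp add: ac_simps)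
  qed
  have BN: "B x \<in> ?N r" and B'N: "B' x \<in> ?N r" if "0 \<le> r" "x \<in> ?N r" for r x
    using inv[OF that b(1) gB] inv[OF that b(2) gB'] by auto
  define C where "C = (D o\<^sub>L B) - (B o\<^sub>L D)"
  have C: "C x = D (B x) - B (D x)" for x by (simp add: C_def blinfun.bilinear_simps)
  have CN: "C x \<in> ?N r" if "0 \<le> r" "x \<in> ?N r" for r x
    unfolding C using that
    by (intro subspace_diff[OF subspace_spectral_subspace] BN spectral_subspace_invariant(1)[OF sD])
  have bound: "norm (C x) \<le> (2 * norm B * d) * norm x" if d: "0 < d" and "x \<in> ?N (real n * d)" for d n x
    using that(2)
  proof (induction n arbitrary: x)
    case 0
    have zero: "D y = 0" if "y \<in> ?N 0" for y
      using norm_power_le_on_spectral_subspace[OF D _ that, of 1] by simp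
    have "C x = 0" using 0 zero BN[of 0 x] by (simp add: C)
    then show ?case using d by simp
  next
    case (Suc n)
    define r where "r = real n * d"
    have r: "0 \<le> r" "0 \<le> r + d" using d by (simp_all add: r_def)
    have rd: "real (Suc n) * d = r + d" by (simp add: r_def algebra_simps)
    have x: "x \<in> ?N (r + d)" using Suc.prems by (simp only: rd)
    obtain p q where pq: "x = p + q" "p \<in> ?N r" "\<And>m. m \<in> ?N r \<Longrightarrow> q \<bullet> m = 0"
      by (rule orthogonal_decomposition[OF subspace_spectral_subspace[of D r] closed_spectral_subspace, where x = x])
        (rule that)
    \<comment> \<open>\<open>q\<close> is the component of \<open>x\<close> over the last interval \<open>(r, r + d]\<close>.\<close>
    have "p \<in> ?N (r + d)" using spectral_subspace_mono[OF D r(1), of "r + d"] pq(2) d by auto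
    then have q: "q \<in> ?N (r + d)"
      using subspace_diff[OF subspace_spectral_subspace x] pq(1) by (metis add_diff_cancel_left')
    have Bq: "B q \<bullet> m = 0" if "m \<in> ?N r" for m using pq(3)[OF B'N[OF r(1) that]] by (simp add: adj)
    have Cq: "C q \<bullet> m = 0" if m: "m \<in> ?N r" for m
      using Bq[OF spectral_subspace_invariant(1)[OF sD m]]
        pq(3)[OF spectral_subspace_invariant(1)[OF sD B'N[OF r(1) m]]]
      by (simp add: C inner_diff_left adj symmetricD[OF sD])
    have nCq: "norm (C q) \<le> (2 * norm B * d) * norm q"
    proof -
      have "C q = (D (B q) - r *\<^sub>R B q) - B (D q - r *\<^sub>R q)" by (simp add: C blinfun.bilinear_simps)
      then have "norm (C q) \<le> norm (D (B q) - r *\<^sub>R B q) + norm (B (D q - r *\<^sub>R q))"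
        by (simp only: norm_triangle_ineq4)
      also have "norm (D (B q) - r *\<^sub>R B q) \<le> d * norm (B q)"
        by (rule spectral_localization[OF sD]) (use d BN[OF r(2) q] Bq in auto)
      also have "d * norm (B q) \<le> d * (norm B * norm q)" using d by (intro mult_left_mono norm_blinfun) auto
      also have "norm (B (D q - r *\<^sub>R q)) \<le> norm B * norm (D q - r *\<^sub>R q)" by (rule norm_blinfun)
      also have "norm B * norm (D q - r *\<^sub>R q) \<le> norm B * (d * norm q)"
        using d q pq(3) by (intro mult_left_mono spectral_localization[OF sD]) auto
      finally show ?thesis by (simp add: algebra_simps)
    qed
    have nCp: "norm (C p) \<le> (2 * norm B * d) * norm p" by (rule Suc.IH) (use pq(2) r_def in simp)
    have "(norm (C x))\<^sup>2 = (norm (C p))\<^sup>2 + (norm (C q))\<^sup>2"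
      unfolding pq(1) blinfun.add_right
      by (rule norm_add_Pythagorean) (use Cq[OF CN[OF r(1) pq(2)]] in \<open>simp add: orthogonal_def inner_commute\<close>)
    also have "\<dots> \<le> ((2 * norm B * d) * norm p)\<^sup>2 + ((2 * norm B * d) * norm q)\<^sup>2"
      using nCp nCq by (intro add_mono power_mono) auto
    also have "\<dots> = (2 * norm B * d)\<^sup>2 * ((norm p)\<^sup>2 + (norm q)\<^sup>2)"
      by (simp add: power_mult_distrib distrib_left)
    also have "(norm p)\<^sup>2 + (norm q)\<^sup>2 = (norm x)\<^sup>2"
      unfolding pq(1)
      by (rule norm_add_Pythagorean[symmetric]) (use pq in \<open>simp add: orthogonal_def inner_commute\<close>)
    finally have "(norm (C x))\<^sup>2 \<le> ((2 * norm B * d) * norm x)\<^sup>2" by (simp add: power_mult_distrib)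
    then show ?case by (rule power2_le_imp_le) (use d in simp)
  qed
  have "C x = 0" for x
  proof -
    have le: "norm (C x) \<le> (2 * norm B * d) * norm x" if d: "0 < d" for d
    proof -
      obtain n where "norm D < real n * d" using reals_Archimedean3[OF d] by blast
      then show ?thesis by (intro bound[OF d, of _ n] spectral_subspace_top[OF D]) simp
    qed
    have "((\<lambda>d. (2 * norm B * d) * norm x) \<longlongrightarrow> (2 * norm B * 0) * norm x) (at_right 0)"
      by (intro tendsto_intros)
    then have "norm (C x) \<le> (2 * norm B * 0) * norm x"
      by (rule tendsto_lowerbound) (use le in \<open>auto intro!: eventually_at_rightI[of 0 1]\<close>)
    then show ?thesis by simp
  qed
  then show ?thesis by (simp add: commute_def C)
qed

section \<open>Normal operators commuting with a hyponormal operator\<close>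

lemma pos_semidef_adjoint_compose:
  fixes T S :: "'a::real_inner \<Rightarrow>\<^sub>L 'a"
  assumes adj: "\<And>x y. T x \<bullet> y = x \<bullet> S y"
  shows "pos_semidef (S o\<^sub>L T)"
proof -
  have adj': "S x \<bullet> y = x \<bullet> T y" for x y using adj[of y x] by (simp add: inner_commute)
  show ?thesis by (simp add: pos_semidef_def symmetric_def adj') (simp flip: adj)
qed

text \<open>
  For normal \<open>A\<close> the operators \<open>A\<^sup>* A\<close> and \<open>A\<^sup>2\<close> produce vectors of equal norm. Replacing the former
  by the latter one factor at a time lets \<open>B\<close> pass through all the factors.
\<close>

lemma growth_bound_of_commuting:
  fixes A A' B :: "'a::real_inner \<Rightarrow>\<^sub>L 'a"
  assumes adj: "\<And>x y. A x \<bullet> y = x \<bullet> A' y" and nor: "\<And>x. A (A' x) = A' (A x)"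
    and AB: "commute A B"
  shows "norm ((blinfun_apply (A' o\<^sub>L A) ^^ n) (B x)) \<le> norm B * norm ((blinfun_apply (A' o\<^sub>L A) ^^ n) x)"
proof -
  let ?D = "blinfun_apply (A' o\<^sub>L A)"
  have nA': "norm (A' x) = norm (A x)" for x
  proof -
    have "A x \<bullet> A x = x \<bullet> A (A' x)" by (simp add: adj nor)
    also have "\<dots> = A' x \<bullet> A' x" using adj[of "A' x" x] by (simp add: inner_commute)
    finally show ?thesis by (simp add: norm_eq)
  qed
  have DA: "(?D ^^ n) (A x) = A ((?D ^^ n) x)" for n x
    by (induction n) (simp_all add: nor)
  have step: "norm ((?D ^^ Suc n) x) = norm ((?D ^^ n) (A (A x)))" for n x
    by (simp add: DA nA')
  show ?thesis
  proof (induction n arbitrary: x)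
    case (Suc n)
    have "norm ((?D ^^ Suc n) (B x)) = norm ((?D ^^ n) (B (A (A x))))"
      unfolding step by (simp only: commuteD[OF AB])
    also have "\<dots> \<le> norm B * norm ((?D ^^ n) (A (A x)))" by (rule Suc.IH)
    finally show ?case unfolding step .
  qed (simp add: norm_blinfun)
qed

text \<open>
  A consequence of Fuglede's theorem that \<open>B\<close> commutes with \<open>A\<^sup>*\<close>, proved here directly. The growth
  bound for \<open>B\<^sup>*\<close> is the preceding lemma for the commuting pair \<open>A\<^sup>*\<close>, \<open>B\<^sup>*\<close>: since
  \<open>A A\<^sup>* = A\<^sup>* A\<close>, it concerns the powers of the same operator.
\<close>

lemma normal_square_commutes:
  fixes A A' B :: "'a::{real_inner,banach} \<Rightarrow>\<^sub>L 'a"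
  assumes adjA: "\<And>x y. A x \<bullet> y = x \<bullet> A' y" and nor: "\<And>x. A (A' x) = A' (A x)"
    and AB: "commute A B"
  shows "commute (A' o\<^sub>L A) B"
proof -
  obtain B' :: "'a \<Rightarrow>\<^sub>L 'a" where adjB: "\<And>x y. B x \<bullet> y = x \<bullet> B' y" by (rule adjoint_exists[of B]) (rule that)
  have adjA': "A' x \<bullet> y = x \<bullet> A y" for x y using adjA[of y x] by (simp add: inner_commute)
  have adjB': "B' x \<bullet> y = x \<bullet> B y" for x y using adjB[of y x] by (simp add: inner_commute)
  have A'B': "commute A' B'"
    unfolding commute_def
  proof
    fix x
    have "A' (B' x) \<bullet> y = B' (A' x) \<bullet> y" for y
      by (simp add: adjA' adjB' commuteD[OF AB])
    then show "A' (B' x) = B' (A' x)" by (metis vector_eq_rdot)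
  qed
  have "A' o\<^sub>L A = A o\<^sub>L A'" by (rule blinfun_eqI) (simp add: nor)
  then have D': "blinfun_apply (A o\<^sub>L A') = blinfun_apply (A' o\<^sub>L A)" by simp
  show ?thesis
  proof (rule commute_if_growth_bounds[OF _ adjB])
    show "pos_semidef (A' o\<^sub>L A)" by (rule pos_semidef_adjoint_compose[OF adjA])
    show "norm ((blinfun_apply (A' o\<^sub>L A) ^^ n) (B x)) \<le> norm B * norm ((blinfun_apply (A' o\<^sub>L A) ^^ n) x)" for n x
      by (rule growth_bound_of_commuting[OF adjA nor AB])
    show "norm ((blinfun_apply (A' o\<^sub>L A) ^^ n) (B' x)) \<le> norm B' * norm ((blinfun_apply (A' o\<^sub>L A) ^^ n) x)" for n x
      using growth_bound_of_commuting[OF adjA' nor[symmetric] A'B', of n x] unfolding D' .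
  qed simp_all
qed

text \<open>
  With \<open>W\<close> the square root of \<open>Q\<close>, which commutes with \<open>P\<close>, the product is \<open>W P W\<close>.
\<close>

lemma pos_semidef_compose:
  fixes P Q :: "'a::{real_inner,banach} \<Rightarrow>\<^sub>L 'a"
  assumes P: "pos_semidef P" and Q: "pos_semidef Q" and PQ: "commute P Q"
  shows "pos_semidef (P o\<^sub>L Q)"
  unfolding pos_semidef_def
proof (intro conjI allI)
  show "symmetric (P o\<^sub>L Q)" by (intro symmetric_intros pos_semidefD(1) P Q PQ)
  obtain W where W: "pos_semidef W" "\<And>x. W (W x) = Q x" "\<And>T. commute T Q \<Longrightarrow> commute T W"
    using positive_root_exists[OF Q] by auto
  fix x
  have "P (Q x) = W (P (W x))" using commuteD[OF W(3)[OF PQ], of "W x"] by (simp add: W(2))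
  then have "(P o\<^sub>L Q) x \<bullet> x = P (W x) \<bullet> W x" by (simp add: symmetricD[OF pos_semidefD(1)[OF W(1)]])
  then show "0 \<le> (P o\<^sub>L Q) x \<bullet> x" using pos_semidefD(2)[OF P, of "W x"] by simp
qed

text \<open>
  Both bounds follow from \<open>\<bar>A x \<bullet> B x\<bar> \<le> P x \<bullet> Q x\<close>, which comes from comparing the symmetric
  part \<open>M\<close> of \<open>B\<^sup>* A\<close> with \<open>R = P Q\<close>.
\<close>

lemma norm_root_diff_le:
  fixes A A' B B' P Q :: "'a::{real_inner,banach} \<Rightarrow>\<^sub>L 'a"
  assumes adjA: "\<And>x y. A x \<bullet> y = x \<bullet> A' y" and adjB: "\<And>x y. B x \<bullet> y = x \<bullet> B' y"
    and nor: "\<And>x. A (A' x) = A' (A x)" and hypo: "\<And>x. norm (B' x) \<le> norm (B x)"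
    and AB: "commute A B"
    and P: "pos_semidef P" "\<And>x. P (P x) = A' (A x)"
    and Q: "pos_semidef Q" "\<And>x. Q (Q x) = B' (B x)"
  shows "norm (P x - Q x) \<le> norm (A x + B x)" "norm (P x - Q x) \<le> norm (A x - B x)"
proof -
  have adjA': "A' x \<bullet> y = x \<bullet> A y" for x y using adjA[of y x] by (simp add: inner_commute)
  have adjB': "B' x \<bullet> y = x \<bullet> B y" for x y using adjB[of y x] by (simp add: inner_commute)
  note sP = symmetricD[OF pos_semidefD(1)[OF P(1)]]
  note sQ = symmetricD[OF pos_semidefD(1)[OF Q(1)]]
  have root_commute: "commute T S"
    if S: "pos_semidef S" "\<And>x. S (S x) = D x" and D: "pos_semidef D" and T: "commute T D"
    for S T D :: "'a \<Rightarrow>\<^sub>L 'a"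
  proof -
    obtain R where R: "pos_semidef R" "\<And>x. R (R x) = D x" "\<And>T. commute T D \<Longrightarrow> commute T R"
      using positive_root_exists[OF D] by auto
    have "R = S" by (rule positive_root_unique[OF R(1) S(1)]) (simp add: R(2) S(2))
    then show ?thesis using R(3)[OF T] by simp
  qed
  have DA: "pos_semidef (A' o\<^sub>L A)" and DB: "pos_semidef (B' o\<^sub>L B)"
    by (rule pos_semidef_adjoint_compose, rule adjA, rule pos_semidef_adjoint_compose, rule adjB)
  have "commute B (A' o\<^sub>L A)" by (rule commute_sym[OF normal_square_commutes[OF adjA nor AB]])
  then have BP: "commute B P" by (intro root_commute[OF P(1) _ DA]) (simp add: P(2))
  have B'P: "commute B' P"
    unfolding commute_def
  proof
    fix x
    have "B' (P x) \<bullet> y = P (B' x) \<bullet> y" for y by (simp add: adjB' sP commuteD[OF BP])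
    then show "B' (P x) = P (B' x)" by (metis vector_eq_rdot)
  qed
  have "commute P (B' o\<^sub>L B)" by (intro commute_intros commute_sym[OF BP] commute_sym[OF B'P])
  then have PQ: "commute P Q" by (intro root_commute[OF Q(1) _ DB]) (simp add: Q(2))
  define R where "R = P o\<^sub>L Q"
  have R: "pos_semidef R" unfolding R_def by (rule pos_semidef_compose[OF P(1) Q(1) PQ])
  have AxAx: "A x \<bullet> A x = P x \<bullet> P x" for x by (simp only: adjA sP P(2))
  have BxBx: "B x \<bullet> B x = Q x \<bullet> Q x" for x by (simp only: adjB sQ Q(2))
  have nA: "norm (A x) = norm (P x)" for x using AxAx[of x] by (simp only: norm_eq)
  have nB: "norm (B x) = norm (Q x)" for x using BxBx[of x] by (simp only: norm_eq)
  have nA': "norm (A' x) = norm (A x)" for x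
  proof -
    have "A' x \<bullet> A' x = x \<bullet> A (A' x)" by (rule adjA')
    also have "\<dots> = A x \<bullet> A x" by (simp only: adjA nor)
    finally show ?thesis by (simp only: norm_eq)
  qed
  have nR: "norm (A (B x)) = norm (R x)" for x
  proof -
    have "norm (A (B x)) = norm (P (B x))" by (rule nA)
    also have "\<dots> = norm (B (P x))" by (simp only: commuteD[OF BP])
    also have "\<dots> = norm (Q (P x))" by (rule nB)
    finally show ?thesis by (simp only: R_def commuteD[OF PQ] blinfun_apply_blinfun_compose)
  qed
  define M where "M = (1/2) *\<^sub>R ((B' o\<^sub>L A) + (A' o\<^sub>L B))"
  have M: "symmetric M"
    by (simp add: symmetric_def M_def blinfun.bilinear_simps inner_simps adjA adjA' adjB adjB')
  have nM: "norm (M x) \<le> norm (R x)" for x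
  proof -
    have "2 * norm (M x) = norm (B' (A x) + A' (B x))" by (simp add: M_def blinfun.bilinear_simps)
    also have "\<dots> \<le> norm (B' (A x)) + norm (A' (B x))" by (rule norm_triangle_ineq)
    also have "norm (B' (A x)) \<le> norm (R x)"
      using hypo[of "A x"] nR[of x] by (simp only: commuteD[OF AB])
    also have "norm (A' (B x)) = norm (R x)" by (simp only: nA' nR)
    finally show ?thesis by simp
  qed
  have Mx: "M x \<bullet> x = A x \<bullet> B x" for x
    by (simp add: M_def blinfun.bilinear_simps inner_simps adjA' adjB' inner_commute[of x]
        inner_commute[of "B x"])
  have Rx: "R x \<bullet> x = P x \<bullet> Q x" for x
    by (simp only: R_def blinfun_apply_blinfun_compose sP inner_commute)
  have up: "A x \<bullet> B x \<le> P x \<bullet> Q x"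
    using form_le_of_norm_le[OF M R nM, of x] by (simp add: Mx Rx)
  have "(- M) x \<bullet> x \<le> R x \<bullet> x"
    by (rule form_le_of_norm_le[OF _ R]) (simp_all add: symmetric_intros(4) M nM blinfun.minus_left)
  then have low: "- (A x \<bullet> B x) \<le> P x \<bullet> Q x" by (simp add: Mx Rx blinfun.minus_left)
  have "(norm (P x - Q x))\<^sup>2 \<le> (norm (A x + B x))\<^sup>2"
    using low by (simp add: power2_norm_eq_inner inner_simps AxAx BxBx inner_commute)
  then show "norm (P x - Q x) \<le> norm (A x + B x)" by (rule power2_le_imp_le) simp
  have "(norm (P x - Q x))\<^sup>2 \<le> (norm (A x - B x))\<^sup>2"
    using up by (simp add: power2_norm_eq_inner inner_simps AxAx BxBx inner_commute)
  then show "norm (P x - Q x) \<le> norm (A x - B x)" by (rule power2_le_imp_le) simp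
qed

section \<open>Complex Hilbert spaces\<close>

instance chilbert_space \<subseteq> banach ..

text \<open>
  The complex inner product is determined by its real part and multiplication by \<open>\<i>\<close>; this carries
  the real results over to complex adjoints and moduli.
\<close>

lemma cinner_eq_inner: "cinner x y = Complex (x \<bullet> y) (x \<bullet> (\<i> *\<^sub>C y))" for x y :: "'a::complex_inner"
proof -
  have "cinner x (\<i> *\<^sub>C y) = cnj (\<i> * cinner y x)"
    by (subst cinner_commute) (simp add: cinner_scaleC_left)
  also have "\<dots> = - \<i> * cinner x y" by (simp add: cinner_commute[of x y])
  finally show ?thesis by (simp add: complex_eq_iff inner_eq_Re_cinner)
qed

lemma inner_scaleC_i: "(\<i> *\<^sub>C x) \<bullet> y = - (x \<bullet> (\<i> *\<^sub>C y))" for x y :: "'a::complex_inner"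
proof -
  have "cinner y (\<i> *\<^sub>C x) = cnj (\<i> * cinner x y)"
    by (subst cinner_commute) (simp add: cinner_scaleC_left)
  then have "y \<bullet> (\<i> *\<^sub>C x) = - Im (cinner x y)" by (simp add: inner_eq_Re_cinner)
  then show ?thesis by (simp add: cinner_eq_inner inner_commute)
qed

lemma scaleC_complex: "c *\<^sub>C x = Re c *\<^sub>R x + Im c *\<^sub>R (\<i> *\<^sub>C x)" for x :: "'a::complex_vector"
proof -
  have "c *\<^sub>C x = (complex_of_real (Re c) + complex_of_real (Im c) * \<i>) *\<^sub>C x"
    by (simp add: complex_eq[symmetric] mult.commute)
  then show ?thesis by (simp add: scaleC_add_left scaleR_scaleC scaleC_scaleC)
qed

lemma bounded_linear_scaleC_i: "bounded_linear (\<lambda>x::'a::complex_inner. \<i> *\<^sub>C x)"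
proof (rule bounded_linear_intro)
  show "\<i> *\<^sub>C (x + y) = \<i> *\<^sub>C x + \<i> *\<^sub>C y" for x y :: 'a by (rule scaleC_add_right)
  show "\<i> *\<^sub>C (r *\<^sub>R x) = r *\<^sub>R (\<i> *\<^sub>C x)" for r and x :: 'a
    by (simp add: scaleR_scaleC scaleC_scaleC mult.commute)
  have "\<i> *\<^sub>C \<i> *\<^sub>C x = - x" for x :: 'a
    using scaleR_scaleC[of "-1" x] by (simp add: scaleC_scaleC)
  then show "norm (\<i> *\<^sub>C x) \<le> norm x * 1" for x :: 'a
    by (simp add: norm_eq_sqrt_inner inner_scaleC_i)
qed

definition imult :: "'a::complex_inner \<Rightarrow>\<^sub>L 'a" where
  "imult = Blinfun (\<lambda>x. \<i> *\<^sub>C x)"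

lemma imult_apply: "imult x = \<i> *\<^sub>C x"
  by (simp add: imult_def bounded_linear_Blinfun_apply bounded_linear_scaleC_i)

lemma bounded_clinear_blinfun_iff:
  "bounded_clinear (blinfun_apply T) \<longleftrightarrow> commute imult T" for T :: "'a::complex_inner \<Rightarrow>\<^sub>L 'a"
proof
  assume "commute imult T"
  then have "T (\<i> *\<^sub>C x) = \<i> *\<^sub>C T x" for x by (simp add: commute_def imult_apply)
  then have "T (c *\<^sub>C x) = c *\<^sub>C T x" for c x
    by (subst (1 2) scaleC_complex) (simp add: blinfun.bilinear_simps)
  then show "bounded_clinear (blinfun_apply T)"
    by (simp add: bounded_clinear_def blinfun.bounded_linear_right)
qed (simp add: bounded_clinear_def commute_def imult_apply)

lemma bounded_clinear_blinfunE:
  assumes "bounded_clinear f"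
  obtains T where "f = blinfun_apply T" "commute imult T"
proof -
  have "f = blinfun_apply (Blinfun f)"
    using assms by (simp add: bounded_clinear_def bounded_linear_Blinfun_apply)
  moreover from this assms have "commute imult (Blinfun f)"
    by (simp flip: bounded_clinear_blinfun_iff)
  ultimately show thesis by (rule that)
qed

text \<open>
  The adjoint for the real inner product is automatically complex linear and is the complex adjoint.
\<close>

lemma adjoint_op_blinfun:
  fixes T S :: "'a::chilbert_space \<Rightarrow>\<^sub>L 'a"
  assumes T: "commute imult T" and adj: "\<And>x y. T x \<bullet> y = x \<bullet> S y"
  shows "adjoint_op (blinfun_apply T) = blinfun_apply S" "commute imult S"
proof -
  have "x \<bullet> S (\<i> *\<^sub>C y) = x \<bullet> (\<i> *\<^sub>C S y)" for x y
    using inner_scaleC_i[of "T x" y] inner_scaleC_i[of x "S y"] commuteD[OF T, of x]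
    by (simp add: imult_apply flip: adj)
  then have Si: "S (\<i> *\<^sub>C y) = \<i> *\<^sub>C S y" for y by (metis vector_eq_ldot)
  then show "commute imult S" by (simp add: commute_def imult_apply)
  show "adjoint_op (blinfun_apply T) = blinfun_apply S"
    unfolding adjoint_op_def
  proof (rule the_equality)
    show "\<forall>x y. cinner (T x) y = cinner x (S y)"
      by (simp add: cinner_eq_inner adj Si)
    show "S' = blinfun_apply S" if "\<forall>x y. cinner (T x) y = cinner x (S' y)" for S'
    proof
      fix y
      have "x \<bullet> S' y = T x \<bullet> y" for x using that by (simp add: inner_eq_Re_cinner)
      then have "x \<bullet> S' y = x \<bullet> S y" for x by (simp only: adj)
      then show "S' y = S y" by (metis vector_eq_ldot)
    qed
  qed
qed

text \<open>
  For complex linear \<open>T\<close> the imaginary part of \<open>cinner (T x) x\<close> is \<open>T x \<bullet> (\<i> *\<^sub>C x)\<close>. It vanishes for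
  all \<open>x\<close> exactly when \<open>T\<close> is symmetric: polarize at \<open>x + \<i> *\<^sub>C y\<close>.
\<close>

lemma positive_op_blinfun_iff:
  fixes T :: "'a::chilbert_space \<Rightarrow>\<^sub>L 'a"
  shows "positive_op (blinfun_apply T) \<longleftrightarrow> commute imult T \<and> pos_semidef T"
proof (cases "commute imult T")
  case T: True
  have Ti: "T (\<i> *\<^sub>C x) = \<i> *\<^sub>C T x" for x
    using commuteD[OF T, of x] by (simp add: imult_apply)
  have ii: "\<i> *\<^sub>C \<i> *\<^sub>C x = - x" for x :: 'a
    using scaleR_scaleC[of "-1" x] by (simp add: scaleC_scaleC)
  have pos: "cinner (T x) x \<in> \<real>\<^sub>\<ge>\<^sub>0 \<longleftrightarrow> 0 \<le> T x \<bullet> x \<and> T x \<bullet> (\<i> *\<^sub>C x) = 0" for x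
    by (auto simp: complex_nonneg_Reals_iff cinner_eq_inner)
  have sym: "symmetric T" if z: "\<And>x. T x \<bullet> (\<i> *\<^sub>C x) = 0"
    unfolding symmetric_def
  proof (intro allI)
    fix x y
    have "T (x + \<i> *\<^sub>C y) \<bullet> (\<i> *\<^sub>C (x + \<i> *\<^sub>C y)) = 0" by (rule z)
    then have "- (T x \<bullet> y) + T (\<i> *\<^sub>C y) \<bullet> (\<i> *\<^sub>C x) = 0"
      using z[of x] z[of "\<i> *\<^sub>C y"]
      by (simp add: blinfun.bilinear_simps scaleC_add_right inner_add_left inner_add_right inner_diff_right ii)
    moreover have "T (\<i> *\<^sub>C y) \<bullet> (\<i> *\<^sub>C x) = T y \<bullet> x" by (simp add: Ti inner_scaleC_i ii)
    ultimately show "T x \<bullet> y = x \<bullet> T y" by (simp add: inner_commute)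
  qed
  have z: "T x \<bullet> (\<i> *\<^sub>C x) = 0" if "symmetric T" for x
  proof -
    have "T x \<bullet> (\<i> *\<^sub>C x) = x \<bullet> (\<i> *\<^sub>C T x)" using symmetricD[OF that, of x "\<i> *\<^sub>C x"] by (simp add: Ti)
    also have "\<dots> = - (T x \<bullet> (\<i> *\<^sub>C x))" using inner_scaleC_i[of x "T x"] by (simp add: inner_commute)
    finally show ?thesis by simp
  qed
  show ?thesis using T sym z by (auto simp: positive_op_def bounded_clinear_blinfun_iff pos pos_semidef_def)
qed (simp add: positive_op_def bounded_clinear_blinfun_iff)

text \<open>
  The real square root of \<open>T\<^sup>* T\<close> commutes with multiplication by \<open>\<i>\<close> because \<open>T\<^sup>* T\<close> does, so it is
  the complex modulus.
\<close>

lemma modulus_op_blinfun: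
  fixes T S :: "'a::chilbert_space \<Rightarrow>\<^sub>L 'a"
  assumes T: "commute imult T" and adj: "\<And>x y. T x \<bullet> y = x \<bullet> S y"
  obtains P where "modulus_op (blinfun_apply T) = blinfun_apply P" "pos_semidef P" "\<And>x. P (P x) = S (T x)"
proof -
  note S = adjoint_op_blinfun[OF T adj]
  have "pos_semidef (S o\<^sub>L T)" by (rule pos_semidef_adjoint_compose[OF adj])
  from positive_root_exists[OF this] obtain P where P: "pos_semidef P" "\<And>x. P (P x) = S (T x)"
      "\<And>U. commute U (S o\<^sub>L T) \<Longrightarrow> commute U P"
    by auto
  have Pi: "commute imult P" by (intro P(3) commute_intros T S(2))
  have "modulus_op (blinfun_apply T) = blinfun_apply P"
    unfolding modulus_op_def S(1)
  proof (rule the_equality)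
    show "positive_op (blinfun_apply P) \<and> blinfun_apply P \<circ> blinfun_apply P = blinfun_apply S \<circ> blinfun_apply T"
      using P Pi by (simp add: positive_op_blinfun_iff fun_eq_iff)
    fix g assume g: "positive_op g \<and> g \<circ> g = blinfun_apply S \<circ> blinfun_apply T"
    then obtain Q where Q: "g = blinfun_apply Q"
      unfolding positive_op_def by (blast elim: bounded_clinear_blinfunE)
    have "Q = P"
      by (rule positive_root_unique) (use g P in \<open>simp_all add: Q positive_op_blinfun_iff fun_eq_iff\<close>)
    then show "g = blinfun_apply P" by (simp add: Q)
  qed
  then show thesis using P(1,2) by (rule that)
qed

theorem corollary3p14:
  fixes A B :: "'a::chilbert_space \<Rightarrow> 'a"
  assumes "bounded_clinear A" and "bounded_clinear B"
    and "A \<circ> B = B \<circ> A"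
    and "normal_op A" and "hyponormal_op B"
  shows "onorm (\<lambda>x. modulus_op A x - modulus_op B x) \<le> onorm (\<lambda>x. A x + B x)
       \<and> onorm (\<lambda>x. modulus_op A x - modulus_op B x) \<le> onorm (\<lambda>x. A x - B x)"
proof -
  obtain S where S: "A = blinfun_apply S" "commute imult S" by (rule bounded_clinear_blinfunE[OF assms(1)])
  obtain T where T: "B = blinfun_apply T" "commute imult T" by (rule bounded_clinear_blinfunE[OF assms(2)])
  obtain S' :: "'a \<Rightarrow>\<^sub>L 'a" where S': "\<And>x y. S x \<bullet> y = x \<bullet> S' y" by (rule adjoint_exists[of S]) (rule that)
  obtain T' :: "'a \<Rightarrow>\<^sub>L 'a" where T': "\<And>x y. T x \<bullet> y = x \<bullet> T' y" by (rule adjoint_exists[of T]) (rule that)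
  obtain P where P: "modulus_op (blinfun_apply S) = blinfun_apply P" "pos_semidef P" "\<And>x. P (P x) = S' (S x)"
    by (rule modulus_op_blinfun[OF S(2) S']) (rule that)
  obtain Q where Q: "modulus_op (blinfun_apply T) = blinfun_apply Q" "pos_semidef Q" "\<And>x. Q (Q x) = T' (T x)"
    by (rule modulus_op_blinfun[OF T(2) T']) (rule that)
  have normal: "S (S' x) = S' (S x)" for x
    using assms(4) unfolding normal_op_def S(1) adjoint_op_blinfun(1)[OF S(2) S']
    by (simp add: fun_eq_iff)
  have hyponormal: "norm (T' x) \<le> norm (T x)" for x
  proof -
    have "0 \<le> Re (cinner (T' (T x) - T (T' x)) x)"
      using assms(5) unfolding hyponormal_op_def T(1) adjoint_op_blinfun(1)[OF T(2) T'] positive_op_def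
      by (simp add: complex_nonneg_Reals_iff)
    then have "T (T' x) \<bullet> x \<le> x \<bullet> T' (T x)" by (simp add: inner_diff_left inner_commute[of x] flip: inner_eq_Re_cinner)
    then have "(norm (T' x))\<^sup>2 \<le> (norm (T x))\<^sup>2" by (simp add: T' power2_norm_eq_inner)
    then show ?thesis by (rule power2_le_imp_le) simp
  qed
  have ST: "commute S T" using assms(3) by (simp add: commute_def S(1) T(1) fun_eq_iff)
  note le = norm_root_diff_le[OF S' T' normal hyponormal ST P(2,3) Q(2,3)]
  have mono: "norm (P - Q) \<le> norm U" if "\<And>x. norm (P x - Q x) \<le> norm (U x)" for U :: "'a \<Rightarrow>\<^sub>L 'a"
    by (rule norm_blinfun_bound) (auto simp: blinfun.diff_left intro: order_trans[OF that norm_blinfun])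
  have "norm (P - Q) \<le> norm (S + T)" "norm (P - Q) \<le> norm (S - T)"
    by (rule mono, simp add: le blinfun.bilinear_simps)+
  then show ?thesis
    unfolding S(1) T(1) P(1) Q(1) norm_blinfun.rep_eq plus_blinfun.rep_eq minus_blinfun.rep_eq by simp
qed

end
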